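(* Let $\mu$ be a finite positive Borel measure on $\mathbb{T}$ with $\mu^c\ll\mu$, $h = d\mu^c/d\mu$, and $\mathcal{H}$ a separable complex Hilbert space. For a closed subspace $\mathcal{K}$ of $\mathscr{L}^2(\mu,\mathcal{H})$ the following are equivalent: (a) $\mathfrak{C}\mathcal{K}\subset\mathcal{K}$ for every conjugation $\mathfrak{C}$ on $\mathscr{L}^2(\mu,\mathcal{H})$ satisfying $\mathfrak{C}\mathbf{M}_\xi\mathfrak{C} = \mathbf{M}_\xi$; (b) for a fixed conjugation $J$ on $\mathcal{H}$, with $(\mathbf{J}^\#\mathbf{f})(\xi) = h(\xi)^{1/2}J(\mathbf{f}(\overline{\xi}))$, the subspace $\mathcal{K}$ is invariant for $\mathbf{J}^\#$ and for every $\mathbf{M}_{\mathbf{F}}$ with $\mathbf{F}$ in $$\mathscr{L}^\infty_c(\mu,\mathcal{B}(\mathcal{H})) := \{\mathbf{F}\in\mathscr{L}^\infty(\mu,\mathcal{B}(\mathcal{H})) : J\mathbf{F}(\xi)J = \mathbf{F}(\overline{\xi})^* \text{ for } \mu\text{-a.e. } \xi\in\mathbb{T}\}.$$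
   Context: A conjugation is an antilinear, isometric map $C$ with $C^2=I$. $\mu^c(\Omega) := \mu(\{\overline{\xi}:\xi\in\Omega\})$. $\mathscr{L}^2(\mu,\mathcal{H})$ is the Hilbert space of $\mathcal{H}$-valued $\mu$-square-integrable functions on $\mathbb{T}$, $\mathscr{L}^\infty(\mu,\mathcal{B}(\mathcal{H}))$ the $\mu$-essentially bounded $\mathcal{B}(\mathcal{H})$-valued functions, $(\mathbf{M}_{\mathbf{F}}\mathbf{f})(\xi) = \mathbf{F}(\xi)\mathbf{f}(\xi)$ and $(\mathbf{M}_\xi\mathbf{f})(\xi) = \xi\mathbf{f}(\xi)$. *)

theory Defs
  imports "HOL-Analysis.Analysis"
begin

text \<open>An abstract complex Hilbert space structure on a type 'h: the additive group
  structure comes from the type class, the complex scalar multiplication is sc and the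
  inner product ip (linear in the first, conjugate-linear in the second argument).\<close>

definition hnorm :: "('h \<Rightarrow> 'h \<Rightarrow> complex) \<Rightarrow> 'h \<Rightarrow> real" where
  "hnorm ip x = sqrt (Re (ip x x))"

definition complex_hilbert ::
  "(complex \<Rightarrow> 'h::ab_group_add \<Rightarrow> 'h) \<Rightarrow> ('h \<Rightarrow> 'h \<Rightarrow> complex) \<Rightarrow> bool" where
  "complex_hilbert sc ip \<longleftrightarrow>
     (\<forall>x. sc 1 x = x) \<and>
     (\<forall>a b x. sc a (sc b x) = sc (a * b) x) \<and>
     (\<forall>a x y. sc a (x + y) = sc a x + sc a y) \<and>
     (\<forall>a b x. sc (a + b) x = sc a x + sc b x) \<and>
     (\<forall>x y z. ip (x + y) z = ip x z + ip y z) \<and>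
     (\<forall>a x y. ip (sc a x) y = a * ip x y) \<and>
     (\<forall>x y. ip y x = cnj (ip x y)) \<and>
     (\<forall>x. 0 \<le> Re (ip x x)) \<and>
     (\<forall>x. ip x x = 0 \<longrightarrow> x = 0) \<and>
     (\<forall>s. (\<forall>e>0. \<exists>N. \<forall>m\<ge>N. \<forall>n\<ge>N. hnorm ip (s m - s n) < e)
           \<longrightarrow> (\<exists>x. (\<lambda>n. hnorm ip (s n - x)) \<longlonglongrightarrow> 0)) \<and>
     (\<exists>D. countable D \<and> (\<forall>x. \<forall>e>0. \<exists>d\<in>D. hnorm ip (x - d) < e))"

definition hconj ::
  "(complex \<Rightarrow> 'h::ab_group_add \<Rightarrow> 'h) \<Rightarrow> ('h \<Rightarrow> 'h \<Rightarrow> complex) \<Rightarrow> ('h \<Rightarrow> 'h) \<Rightarrow> bool" where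
  "hconj sc ip J \<longleftrightarrow>
     (\<forall>x y. J (x + y) = J x + J y) \<and>
     (\<forall>a x. J (sc a x) = sc (cnj a) (J x)) \<and>
     (\<forall>x. hnorm ip (J x) = hnorm ip x) \<and>
     (\<forall>x. J (J x) = x)"

definition hbounded_linear ::
  "(complex \<Rightarrow> 'h::ab_group_add \<Rightarrow> 'h) \<Rightarrow> ('h \<Rightarrow> 'h \<Rightarrow> complex) \<Rightarrow> ('h \<Rightarrow> 'h) \<Rightarrow> bool" where
  "hbounded_linear sc ip A \<longleftrightarrow>
     (\<forall>x y. A (x + y) = A x + A y) \<and>
     (\<forall>a x. A (sc a x) = sc a (A x)) \<and>
     (\<exists>K. \<forall>x. hnorm ip (A x) \<le> K * hnorm ip x)"

definition hadjoint :: "('h \<Rightarrow> 'h \<Rightarrow> complex) \<Rightarrow> ('h \<Rightarrow> 'h) \<Rightarrow> ('h \<Rightarrow> 'h) \<Rightarrow> bool" where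
  "hadjoint ip A B \<longleftrightarrow> (\<forall>x y. ip (B x) y = ip x (A y))"

abbreviation circle :: "complex set" where
  "circle \<equiv> sphere 0 1"

text \<open>Measurability of H-valued functions (weak = strong for separable H, Pettis).\<close>
definition hmeasurable :: "('h \<Rightarrow> 'h \<Rightarrow> complex) \<Rightarrow> complex measure \<Rightarrow> (complex \<Rightarrow> 'h) \<Rightarrow> bool" where
  "hmeasurable ip \<mu> f \<longleftrightarrow> (\<forall>e. (\<lambda>\<xi>. ip (f \<xi>) e) \<in> borel_measurable \<mu>)"

text \<open>Square-integrable H-valued functions (representatives of elements of L2(mu,H)).\<close>
definition L2 :: "('h \<Rightarrow> 'h \<Rightarrow> complex) \<Rightarrow> complex measure \<Rightarrow> (complex \<Rightarrow> 'h) set" where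
  "L2 ip \<mu> = {f. hmeasurable ip \<mu> f \<and> integrable \<mu> (\<lambda>\<xi>. (hnorm ip (f \<xi>))\<^sup>2)}"

definition l2norm :: "('h \<Rightarrow> 'h \<Rightarrow> complex) \<Rightarrow> complex measure \<Rightarrow> (complex \<Rightarrow> 'h) \<Rightarrow> real" where
  "l2norm ip \<mu> f = sqrt (\<integral>\<xi>. (hnorm ip (f \<xi>))\<^sup>2 \<partial>\<mu>)"

definition aeq :: "complex measure \<Rightarrow> (complex \<Rightarrow> 'h) \<Rightarrow> (complex \<Rightarrow> 'h) \<Rightarrow> bool" where
  "aeq \<mu> f g \<longleftrightarrow> (AE \<xi> in \<mu>. f \<xi> = g \<xi>)"

definition L2_closed_subspace ::
  "(complex \<Rightarrow> 'h::ab_group_add \<Rightarrow> 'h) \<Rightarrow> ('h \<Rightarrow> 'h \<Rightarrow> complex) \<Rightarrow> complex measure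
    \<Rightarrow> (complex \<Rightarrow> 'h) set \<Rightarrow> bool" where
  "L2_closed_subspace sc ip \<mu> K \<longleftrightarrow>
     K \<subseteq> L2 ip \<mu> \<and>
     (\<forall>f\<in>K. \<forall>g\<in>L2 ip \<mu>. aeq \<mu> f g \<longrightarrow> g \<in> K) \<and>
     (\<lambda>_. 0) \<in> K \<and>
     (\<forall>f\<in>K. \<forall>g\<in>K. (\<lambda>\<xi>. f \<xi> + g \<xi>) \<in> K) \<and>
     (\<forall>a. \<forall>f\<in>K. (\<lambda>\<xi>. sc a (f \<xi>)) \<in> K) \<and>
     (\<forall>s f. (\<forall>n. s n \<in> K) \<longrightarrow> f \<in> L2 ip \<mu> \<longrightarrow>
        (\<lambda>n. l2norm ip \<mu> (\<lambda>\<xi>. s n \<xi> - f \<xi>)) \<longlonglongrightarrow> 0 \<longrightarrow> f \<in> K)"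

definition L2_conj ::
  "(complex \<Rightarrow> 'h::ab_group_add \<Rightarrow> 'h) \<Rightarrow> ('h \<Rightarrow> 'h \<Rightarrow> complex) \<Rightarrow> complex measure
    \<Rightarrow> ((complex \<Rightarrow> 'h) \<Rightarrow> (complex \<Rightarrow> 'h)) \<Rightarrow> bool" where
  "L2_conj sc ip \<mu> C \<longleftrightarrow>
     (\<forall>f\<in>L2 ip \<mu>. C f \<in> L2 ip \<mu>) \<and>
     (\<forall>f\<in>L2 ip \<mu>. \<forall>g\<in>L2 ip \<mu>. aeq \<mu> f g \<longrightarrow> aeq \<mu> (C f) (C g)) \<and>
     (\<forall>f\<in>L2 ip \<mu>. \<forall>g\<in>L2 ip \<mu>. aeq \<mu> (C (\<lambda>\<xi>. f \<xi> + g \<xi>)) (\<lambda>\<xi>. C f \<xi> + C g \<xi>)) \<and>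
     (\<forall>a. \<forall>f\<in>L2 ip \<mu>. aeq \<mu> (C (\<lambda>\<xi>. sc a (f \<xi>))) (\<lambda>\<xi>. sc (cnj a) (C f \<xi>))) \<and>
     (\<forall>f\<in>L2 ip \<mu>. l2norm ip \<mu> (C f) = l2norm ip \<mu> f) \<and>
     (\<forall>f\<in>L2 ip \<mu>. aeq \<mu> (C (C f)) f)"

definition commutes_Mxi ::
  "(complex \<Rightarrow> 'h \<Rightarrow> 'h) \<Rightarrow> ('h \<Rightarrow> 'h \<Rightarrow> complex) \<Rightarrow> complex measure
    \<Rightarrow> ((complex \<Rightarrow> 'h) \<Rightarrow> (complex \<Rightarrow> 'h)) \<Rightarrow> bool" where
  "commutes_Mxi sc ip \<mu> C \<longleftrightarrow>
     (\<forall>f\<in>L2 ip \<mu>. aeq \<mu> (C (\<lambda>\<xi>. sc \<xi> (C f \<xi>))) (\<lambda>\<xi>. sc \<xi> (f \<xi>)))"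

definition Jsharp ::
  "(complex \<Rightarrow> 'h \<Rightarrow> 'h) \<Rightarrow> complex measure \<Rightarrow> ('h \<Rightarrow> 'h) \<Rightarrow> (complex \<Rightarrow> 'h) \<Rightarrow> (complex \<Rightarrow> 'h)" where
  "Jsharp sc \<mu> J f = (\<lambda>\<xi>. sc (complex_of_real (sqrt (enn2real (RN_deriv \<mu> (distr \<mu> \<mu> cnj) \<xi>))))
                                (J (f (cnj \<xi>))))"

definition Linf_op ::
  "(complex \<Rightarrow> 'h::ab_group_add \<Rightarrow> 'h) \<Rightarrow> ('h \<Rightarrow> 'h \<Rightarrow> complex) \<Rightarrow> complex measure
    \<Rightarrow> (complex \<Rightarrow> 'h \<Rightarrow> 'h) set" where
  "Linf_op sc ip \<mu> = {F.
     (\<forall>\<xi>\<in>space \<mu>. hbounded_linear sc ip (F \<xi>)) \<and>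
     (\<forall>x y. (\<lambda>\<xi>. ip (F \<xi> x) y) \<in> borel_measurable \<mu>) \<and>
     (\<exists>M. AE \<xi> in \<mu>. \<forall>x. hnorm ip (F \<xi> x) \<le> M * hnorm ip x)}"

definition Linf_c ::
  "(complex \<Rightarrow> 'h::ab_group_add \<Rightarrow> 'h) \<Rightarrow> ('h \<Rightarrow> 'h \<Rightarrow> complex) \<Rightarrow> complex measure
    \<Rightarrow> ('h \<Rightarrow> 'h) \<Rightarrow> (complex \<Rightarrow> 'h \<Rightarrow> 'h) set" where
  "Linf_c sc ip \<mu> J = {F \<in> Linf_op sc ip \<mu>.
     AE \<xi> in \<mu>. hadjoint ip (F (cnj \<xi>)) (\<lambda>x. J (F \<xi> (J x)))}"

end

theory Submission
  imports Defs
begin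

text \<open>
  For (b) implies (a), let \<open>C\<close> be a conjugation commuting with \<open>M\<^sub>\<xi>\<close> and put \<open>U = J\<^sup># C\<close>. This
  isometry commutes with multiplication by all real polynomials on the circle, so by
  Stone--Weierstrass it preserves inner products pointwise almost everywhere. Hence it acts
  fibrewise by isometries \<open>F(\<xi>)\<close>, which are determined by the images of countably many constant
  functions, and \<open>J\<^sup># U J\<^sup># U = C C = 1\<close> makes \<open>F\<close> symmetric.

  For (a) implies (b), \<open>J\<^sup># M\<^sub>V\<close> is a conjugation commuting with \<open>M\<^sub>\<xi>\<close> for every symmetric unitary
  \<open>V\<close>, so \<open>K\<close> is invariant under \<open>M\<^sub>V\<close>. A symmetric \<open>F\<close> is \<open>A + \<i>B\<close> with \<open>A\<close>, \<open>B\<close> selfadjoint and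
  symmetric, and a selfadjoint symmetric \<open>T\<close> is recovered from the Cayley transforms of \<open>tT\<close>,
  which are symmetric unitaries, as \<open>t \<rightarrow> 0\<close>. The adjoint of \<open>F(\<xi>)\<close> exists without appeal to the
  Riesz theorem, being \<open>J F(\<xi>\<^sup>*) J\<close>, where \<open>\<xi>\<^sup>*\<close> is the complex conjugate of \<open>\<xi>\<close>.
\<close>

section \<open>Abstract Hilbert spaces\<close>

locale hilbert_structure =
  fixes sc :: "complex \<Rightarrow> 'h::ab_group_add \<Rightarrow> 'h" and ip :: "'h \<Rightarrow> 'h \<Rightarrow> complex"
  assumes H: "complex_hilbert sc ip"
begin

sublocale vector_space sc
  by unfold_locales (use H in \<open>auto simp: complex_hilbert_def\<close>)

abbreviation nrm :: "'h \<Rightarrow> real" where "nrm \<equiv> hnorm ip"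

section \<open>Inner product and norm\<close>

lemma
  shows ip_add_left: "ip (x + y) z = ip x z + ip y z"
    and ip_scale_left: "ip (sc a x) z = a * ip x z"
    and ip_commute: "ip y x = cnj (ip x y)"
    and ip_ge_0: "0 \<le> Re (ip x x)"
    and ip_eq_0D: "ip x x = 0 \<Longrightarrow> x = 0"
proof -
  note * = H[unfolded complex_hilbert_def, THEN conjunct2, THEN conjunct2, THEN conjunct2, THEN conjunct2]
  show "ip (x + y) z = ip x z + ip y z"
    by (rule *[THEN conjunct1, rule_format])
  show "ip (sc a x) z = a * ip x z"
    by (rule *[THEN conjunct2, THEN conjunct1, rule_format])
  show "ip y x = cnj (ip x y)"
    by (rule *[THEN conjunct2, THEN conjunct2, THEN conjunct1, rule_format])
  show "0 \<le> Re (ip x x)"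
    by (rule *[THEN conjunct2, THEN conjunct2, THEN conjunct2, THEN conjunct1, rule_format])
  show "ip x x = 0 \<Longrightarrow> x = 0"
    by (rule *[THEN conjunct2, THEN conjunct2, THEN conjunct2, THEN conjunct2, THEN conjunct1, rule_format])
qed

lemma complete:
  assumes "\<And>e. e > 0 \<Longrightarrow> \<exists>N. \<forall>m\<ge>N. \<forall>n\<ge>N. nrm (s m - s n) < e"
  obtains x where "(\<lambda>n. nrm (s n - x)) \<longlonglongrightarrow> 0"
proof -
  have "\<forall>s. (\<forall>e>0. \<exists>N. \<forall>m\<ge>N. \<forall>n\<ge>N. nrm (s m - s n) < e)
    \<longrightarrow> (\<exists>x. (\<lambda>n. nrm (s n - x)) \<longlonglongrightarrow> 0)"
    using H unfolding complex_hilbert_def by (elim conjE)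
  then show ?thesis using assms that by presburger
qed

lemma dense_sequence:
  obtains d :: "nat \<Rightarrow> 'h" where "\<And>x e. e > 0 \<Longrightarrow> \<exists>k. nrm (x - d k) < e"
proof -
  have "\<exists>D. countable D \<and> (\<forall>x. \<forall>e>0. \<exists>d\<in>D. nrm (x - d) < e)"
    using H unfolding complex_hilbert_def by (elim conjE)
  then obtain D where D: "countable D" "\<And>x e. e > 0 \<Longrightarrow> \<exists>d\<in>D. nrm (x - d) < e"
    by blast
  then have "D \<noteq> {}" using zero_less_one by blast
  then have "range (from_nat_into D) = D"
    using D(1) by (simp add: range_from_nat_into)
  then show ?thesis
    using D(2) by (intro that[of "from_nat_into D"]) (metis imageE)
qed

lemma ip_add_right: "ip x (y + z) = ip x y + ip x z"
  by (metis complex_cnj_add ip_add_left ip_commute)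

lemma ip_scale_right: "ip x (sc a y) = cnj a * ip x y"
  by (metis complex_cnj_mult ip_scale_left ip_commute)

lemma ip_zero_left [simp]: "ip 0 x = 0" and ip_zero_right [simp]: "ip x 0 = 0"
  using ip_scale_left[of 0 0 x] ip_scale_right[of x 0 0] by auto

lemma ip_minus_left: "ip (- x) y = - ip x y" and ip_minus_right: "ip x (- y) = - ip x y"
  using ip_scale_left[of "-1" x y] ip_scale_right[of x "-1" y] by (auto simp: scale_minus_left)

lemma ip_diff_left: "ip (x - y) z = ip x z - ip y z"
  and ip_diff_right: "ip z (x - y) = ip z x - ip z y"
  using ip_add_left[of x "-y"] ip_add_right[of z x "-y"] by (auto simp: ip_minus_left ip_minus_right)

lemmas ip_simps = ip_add_left ip_add_right ip_scale_left ip_scale_right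
  ip_minus_left ip_minus_right ip_diff_left ip_diff_right

lemma nrm_sq: "(nrm x)\<^sup>2 = Re (ip x x)"
  unfolding hnorm_def using ip_ge_0 by simp

lemma ip_self: "ip x x = of_real ((nrm x)\<^sup>2)"
  using ip_commute[of x x] by (auto simp: nrm_sq complex_eq_iff)

lemma nrm_ge_0 [simp]: "0 \<le> nrm x"
  unfolding hnorm_def using ip_ge_0 by simp

lemma nrm_zero [simp]: "nrm 0 = 0"
  by (simp add: hnorm_def)

lemma nrm_eq_0 [simp]: "nrm x = 0 \<longleftrightarrow> x = 0"
  using ip_self[of x] ip_eq_0D[of x] by auto

lemma nrm_scale: "nrm (sc a x) = cmod a * nrm x"
proof -
  have "(nrm (sc a x))\<^sup>2 = Re ((a * cnj a) * ip x x)"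
    by (simp add: nrm_sq ip_simps mult_ac)
  also have "\<dots> = (cmod a * nrm x)\<^sup>2"
    by (simp add: ip_self complex_norm_square[symmetric] power_mult_distrib
        flip: of_real_power of_real_mult)
  finally show ?thesis
    by (simp add: power2_eq_iff_nonneg)
qed

lemma nrm_minus [simp]: "nrm (- x) = nrm x"
  using nrm_scale[of "-1" x] by (simp add: scale_minus_left)

lemma nrm_minus_commute: "nrm (x - y) = nrm (y - x)"
  by (metis minus_diff_eq nrm_minus)

lemma nrm_add_sq: "(nrm (x + y))\<^sup>2 = (nrm x)\<^sup>2 + (nrm y)\<^sup>2 + 2 * Re (ip x y)"
  using ip_commute[of x y] by (simp add: nrm_sq ip_simps)

lemma nrm_diff_sq: "(nrm (x - y))\<^sup>2 = (nrm x)\<^sup>2 + (nrm y)\<^sup>2 - 2 * Re (ip x y)"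
  using ip_commute[of x y] by (simp add: nrm_sq ip_simps)

text \<open>Polarization converts norm identities, which are what isometries supply directly, into
  identities between inner products.\<close>

lemma Re_ip_polar: "Re (ip x y) = ((nrm (x + y))\<^sup>2 - (nrm x)\<^sup>2 - (nrm y)\<^sup>2) / 2"
  by (simp add: nrm_add_sq)

lemma Im_ip_eq: "Im (ip x y) = Re (ip x (sc \<i> y))"
  by (simp add: ip_simps)

lemma Cauchy_Schwarz: "cmod (ip x y) \<le> nrm x * nrm y"
proof (cases "y = 0")
  case False
  \<comment> \<open>\<open>sc c y\<close> is the orthogonal projection of \<open>x\<close> onto the
    line of \<open>y\<close>; nonnegativity of the squared remainder is the claim.\<close>
  define c where "c = ip x y / of_real ((nrm y)\<^sup>2)"
  have y: "(nrm y)\<^sup>2 > 0" using False by simp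
  have "ip x (sc c y) = of_real ((cmod (ip x y))\<^sup>2 / (nrm y)\<^sup>2)"
    unfolding c_def ip_scale_right
    by (simp add: complex_norm_square[symmetric] mult.commute)
  moreover have "(nrm (sc c y))\<^sup>2 = (cmod (ip x y))\<^sup>2 / (nrm y)\<^sup>2"
  proof -
    have "cmod c = cmod (ip x y) / (nrm y)\<^sup>2"
      unfolding c_def norm_divide norm_of_real by simp
    then show ?thesis using y by (simp add: nrm_scale field_simps power2_eq_square)
  qed
  ultimately have "0 \<le> (nrm x)\<^sup>2 - (cmod (ip x y))\<^sup>2 / (nrm y)\<^sup>2"
    using nrm_diff_sq[of x "sc c y"] by simp (smt (verit) zero_le_power2)
  then have "(cmod (ip x y))\<^sup>2 \<le> (nrm x * nrm y)\<^sup>2"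
    using y by (simp add: field_simps power_mult_distrib)
  then show ?thesis by (rule power2_le_imp_le) simp
qed simp

lemma nrm_triangle: "nrm (x + y) \<le> nrm x + nrm y"
proof (rule power2_le_imp_le)
  have "Re (ip x y) \<le> nrm x * nrm y"
    using Cauchy_Schwarz[of x y] complex_Re_le_cmod[of "ip x y"] by linarith
  then show "(nrm (x + y))\<^sup>2 \<le> (nrm x + nrm y)\<^sup>2"
    by (simp add: nrm_add_sq power2_sum)
qed simp

lemma nrm_triangle_diff: "nrm (x - z) \<le> nrm (x - y) + nrm (y - z)"
  using nrm_triangle[of "x - y" "y - z"] by simp

text \<open>By the parallelogram law the two sides differ by the square of
  \<open>nrm (x - y)\<close>. The bound supplies the integrable majorant for sums.\<close>

lemma nrm_add_sq_le: "(nrm (x + y))\<^sup>2 \<le> 2 * (nrm x)\<^sup>2 + 2 * (nrm y)\<^sup>2"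
  using nrm_add_sq[of x y] nrm_diff_sq[of x y] zero_le_power2[of "nrm (x - y)"] by linarith

text \<open>The hypotheses make the expansion of the squared norm of \<open>x - y\<close> vanish.
  This recognizes a vector from its norm and a single inner product.\<close>

lemma eq_if_ip_eq:
  assumes "(nrm x)\<^sup>2 = (nrm y)\<^sup>2" "ip x y = ip y y"
  shows "x = y"
proof -
  have "(nrm (x - y))\<^sup>2 = 0"
    unfolding nrm_diff_sq assms by (simp add: nrm_sq)
  then show ?thesis by simp
qed

section \<open>Limits of inner products and extension of isometries\<close>

lemma tendsto_ip_left:
  assumes "(\<lambda>n. nrm (s n - x)) \<longlonglongrightarrow> 0"
  shows "(\<lambda>n. ip (s n) y) \<longlonglongrightarrow> ip x y"
proof -
  have "(\<lambda>n. nrm (s n - x) * nrm y) \<longlonglongrightarrow> 0"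
    using tendsto_mult_right[OF assms, of "nrm y"] by simp
  then have "(\<lambda>n. ip (s n - x) y) \<longlonglongrightarrow> 0"
    by (rule Lim_null_comparison[rotated]) (simp add: Cauchy_Schwarz)
  then show ?thesis
    by (simp add: ip_diff_left LIM_zero_iff)
qed

lemma tendsto_ip:
  assumes s: "(\<lambda>n. nrm (s n - x)) \<longlonglongrightarrow> 0" and t: "(\<lambda>n. nrm (t n - y)) \<longlonglongrightarrow> 0"
  shows "(\<lambda>n. ip (s n) (t n)) \<longlonglongrightarrow> ip x y"
proof -
  have le: "cmod (ip (s n) (t n - y)) \<le> (nrm (s n - x) + nrm x) * nrm (t n - y)" for n
    using nrm_triangle[of "s n - x" x] Cauchy_Schwarz[of "s n" "t n - y"]
    by simp (meson mult_right_mono nrm_ge_0 order_trans)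
  have "(\<lambda>n. (nrm (s n - x) + nrm x) * nrm (t n - y)) \<longlonglongrightarrow> (0 + nrm x) * 0"
    by (intro tendsto_intros s t)
  then have "(\<lambda>n. ip (s n) (t n - y)) \<longlonglongrightarrow> 0"
    by (intro Lim_null_comparison[OF always_eventually[rule_format, OF le]]) simp
  from tendsto_add[OF this tendsto_ip_left[OF s, of y]] show ?thesis
    by (simp add: ip_diff_right)
qed

lemma approx_sequence:
  fixes d :: "nat \<Rightarrow> 'h"
  assumes "\<And>x e. e > 0 \<Longrightarrow> \<exists>k. nrm (x - d k) < e"
  obtains k :: "nat \<Rightarrow> nat" where "(\<lambda>n. nrm (d (k n) - x)) \<longlonglongrightarrow> 0"
proof -
  have "\<exists>k. nrm (x - d k) < 1 / real (Suc n)" for n by (rule assms) simp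
  then obtain k where k: "nrm (x - d (k n)) < 1 / real (Suc n)" for n by metis
  have "(\<lambda>n. nrm (d (k n) - x)) \<longlonglongrightarrow> 0"
  proof (rule Lim_null_comparison)
    show "\<forall>\<^sub>F n in sequentially. norm (nrm (d (k n) - x)) \<le> inverse (real (Suc n))"
      using k by (auto simp: nrm_minus_commute[of _ x] inverse_eq_divide less_imp_le)
  qed (rule LIMSEQ_inverse_real_of_nat)
  then show ?thesis by (rule that)
qed

text \<open>The defect of additivity or homogeneity has vanishing inner product with itself once it
  is expanded.\<close>

lemma ip_preserving_linear:
  assumes V: "\<And>x y. ip (V x) (V y) = ip x y"
  shows "V (x + y) = V x + V y" "V (sc a x) = sc a (V x)" "nrm (V x) = nrm x"
proof -
  have "ip (V (x + y) - (V x + V y)) (V (x + y) - (V x + V y)) = 0"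
    by (simp add: ip_simps V)
  then show "V (x + y) = V x + V y" using ip_eq_0D eq_iff_diff_eq_0 by blast
  have "ip (V (sc a x) - sc a (V x)) (V (sc a x) - sc a (V x)) = 0"
    by (simp add: ip_simps V)
  then show "V (sc a x) = sc a (V x)" using ip_eq_0D eq_iff_diff_eq_0 by blast
  show "nrm (V x) = nrm x" by (simp add: hnorm_def V)
qed

lemma isometry_extension:
  fixes d g :: "nat \<Rightarrow> 'h"
  assumes d: "\<And>x e. e > 0 \<Longrightarrow> \<exists>k. nrm (x - d k) < e"
    and g: "\<And>k l. ip (g k) (g l) = ip (d k) (d l)"
  obtains V where "\<And>x y. ip (V x) (V y) = ip x y" "\<And>k. V (d k) = g k"
proof -
  have "\<exists>v k. (\<lambda>n. nrm (d (k n) - x)) \<longlonglongrightarrow> 0 \<and> (\<lambda>n. nrm (g (k n) - v)) \<longlonglongrightarrow> 0" for x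
  proof -
    obtain k where k: "(\<lambda>n. nrm (d (k n) - x)) \<longlonglongrightarrow> 0"
      using approx_sequence[of d, OF d] by blast
    have gd: "nrm (g i - g j) = nrm (d i - d j)" for i j
      by (simp add: hnorm_def ip_simps g)
    have "\<exists>N. \<forall>m\<ge>N. \<forall>n\<ge>N. nrm (g (k m) - g (k n)) < e" if "e > 0" for e
    proof -
      from LIMSEQ_D[OF k, of "e/2"] that
      obtain N where N: "\<And>n. n \<ge> N \<Longrightarrow> nrm (d (k n) - x) < e / 2" by auto
      have "nrm (d (k m) - d (k n)) < e" if "m \<ge> N" "n \<ge> N" for m n
        using nrm_triangle_diff[of "d (k m)" "d (k n)" x] N[OF that(1)] N[OF that(2)]
        by (simp add: nrm_minus_commute[of x])
      then show ?thesis by (auto simp: gd)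
    qed
    then obtain v where "(\<lambda>n. nrm (g (k n) - v)) \<longlonglongrightarrow> 0"
      using complete[of "\<lambda>n. g (k n)"] by blast
    with k show ?thesis by blast
  qed
  then obtain V k where k: "\<And>x. (\<lambda>n. nrm (d (k x n) - x)) \<longlonglongrightarrow> 0"
    and V: "\<And>x. (\<lambda>n. nrm (g (k x n) - V x)) \<longlonglongrightarrow> 0" by metis
  have *: "ip (V x) (V y) = ip x y" for x y
    using tendsto_ip[OF V[of x] V[of y]] tendsto_ip[OF k[of x] k[of y]]
    unfolding g by (rule LIMSEQ_unique)
  \<comment> \<open>The sequence chosen to approximate \<open>d j\<close> may vary, so the value
    there is identified through inner products.\<close>
  have "V (d j) = g j" for j
  proof (rule eq_if_ip_eq)
    show "(nrm (V (d j)))\<^sup>2 = (nrm (g j))\<^sup>2" by (simp add: nrm_sq * g)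
    have "ip (V (d j)) (g j) = ip (d j) (d j)"
      using tendsto_ip_left[OF V[of "d j"], of "g j"] tendsto_ip_left[OF k[of "d j"], of "d j"]
      unfolding g by (rule LIMSEQ_unique)
    then show "ip (V (d j)) (g j) = ip (g j) (g j)" by (simp add: g)
  qed
  with * show ?thesis by (rule that)
qed

section \<open>Resolvents and Cayley transforms of small selfadjoint operators\<close>

text \<open>For \<open>S\<close> of norm at most \<open>1/2\<close> this iteration converges to \<open>(1 - \<i>S)\<^sup>-\<^sup>1 x\<close>; it serves to show
  that the resolvent depends measurably on parameters.\<close>

definition neumann :: "('h \<Rightarrow> 'h) \<Rightarrow> 'h \<Rightarrow> nat \<Rightarrow> 'h" where
  "neumann S x n = ((\<lambda>y. x + sc \<i> (S y)) ^^ n) 0"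

lemma neumann_simps [simp]:
  "neumann S x 0 = 0" "neumann S x (Suc n) = x + sc \<i> (S (neumann S x n))"
  by (simp_all add: neumann_def)

text \<open>The inverse of \<open>1 - \<i>S\<close> at \<open>x\<close>; the description becomes
  meaningful once existence and uniqueness are shown for small selfadjoint \<open>S\<close>.\<close>

definition resolvent :: "('h \<Rightarrow> 'h) \<Rightarrow> 'h \<Rightarrow> 'h" where
  "resolvent S x = (THE y. y - sc \<i> (S y) = x)"

text \<open>The bound \<open>1/2\<close> makes the Neumann iteration a contraction; bounded
  selfadjoint operators are rescaled to meet it.\<close>

definition selfadjoint_half :: "('h \<Rightarrow> 'h) \<Rightarrow> bool" where
  "selfadjoint_half S \<longleftrightarrow> (\<forall>x y. S (x + y) = S x + S y) \<and> (\<forall>a x. S (sc a x) = sc a (S x)) \<and>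
     (\<forall>x. nrm (S x) \<le> nrm x / 2) \<and> (\<forall>x y. ip (S x) y = ip x (S y))"

text \<open>Since \<open>1 + \<i>S = 2 - (1 - \<i>S)\<close>, this is the Cayley transform
  \<open>(1 + \<i>S)(1 - \<i>S)\<^sup>-\<^sup>1\<close>.\<close>

definition cayley :: "('h \<Rightarrow> 'h) \<Rightarrow> 'h \<Rightarrow> 'h" where
  "cayley S x = sc 2 (resolvent S x) - x"

context
  fixes S assumes S: "selfadjoint_half S"
begin

lemma
  shows S_add: "S (x + y) = S x + S y"
    and S_scale: "S (sc a x) = sc a (S x)"
    and S_bound: "nrm (S x) \<le> nrm x / 2"
    and S_self: "ip (S x) y = ip x (S y)"
  using S unfolding selfadjoint_half_def by blast+

lemma S_diff: "S (x - y) = S x - S y"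
  by (metis S_add add_diff_cancel diff_add_cancel)

text \<open>Selfadjointness makes \<open>ip y (S y)\<close> real, so the cross term is purely
  imaginary and drops out of both squares.\<close>

lemma nrm_shift_sq: "(nrm (y - sc \<i> (S y)))\<^sup>2 = (nrm y)\<^sup>2 + (nrm (S y))\<^sup>2"
    "(nrm (y + sc \<i> (S y)))\<^sup>2 = (nrm y)\<^sup>2 + (nrm (S y))\<^sup>2"
proof -
  have "Im (ip y (S y)) = 0"
    using ip_commute[of y "S y"] S_self[of y y] by (simp add: complex_eq_iff)
  then show "(nrm (y - sc \<i> (S y)))\<^sup>2 = (nrm y)\<^sup>2 + (nrm (S y))\<^sup>2"
    "(nrm (y + sc \<i> (S y)))\<^sup>2 = (nrm y)\<^sup>2 + (nrm (S y))\<^sup>2"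
    by (simp_all add: nrm_diff_sq nrm_add_sq nrm_scale ip_scale_right)
qed

text \<open>The radius is stable under one step, since \<open>nrm x + (2 * nrm x) / 2\<close> is
  again \<open>2 * nrm x\<close>.\<close>

lemma neumann_bound: "nrm (neumann S x n) \<le> 2 * nrm x"
proof (induction n)
  case (Suc n)
  then show ?case
    using nrm_triangle[of x "sc \<i> (S (neumann S x n))"] S_bound[of "neumann S x n"]
    by (simp add: nrm_scale)
qed simp

lemma neumann_diff: "nrm (neumann S x (n + k) - neumann S x n) \<le> 2 * nrm x * (1/2) ^ n"
proof (induction n)
  case 0
  show ?case using neumann_bound by simp
next
  case (Suc n)
  have "nrm (neumann S x (Suc n + k) - neumann S x (Suc n))
     = nrm (S (neumann S x (n + k) - neumann S x n))"
    using nrm_scale[of \<i> "S (neumann S x (n + k) - neumann S x n)"]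
    by (simp add: S_diff scale_right_diff_distrib)
  also have "\<dots> \<le> nrm (neumann S x (n + k) - neumann S x n) / 2" by (rule S_bound)
  finally show ?case using Suc by simp
qed

lemma resolvent_unique:
  assumes "y - sc \<i> (S y) = z - sc \<i> (S z)"
  shows "y = z"
proof -
  have "(y - z) - sc \<i> (S (y - z)) = 0"
    using assms by (simp add: S_diff scale_right_diff_distrib algebra_simps)
  then show ?thesis using nrm_shift_sq(1)[of "y - z"]
    by (metis add_nonneg_eq_0_iff eq_iff_diff_eq_0 nrm_eq_0 nrm_zero power_zero_numeral zero_eq_power2 zero_le_power2)
qed

text \<open>The iterates are Cauchy by the geometric bound, and their limit solves
  \<open>y = x + \<i>S y\<close>, whose solution is unique.\<close>

lemma neumann_tendsto_resolvent: "(\<lambda>n. nrm (neumann S x n - resolvent S x)) \<longlonglongrightarrow> 0"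
  and resolvent_eq: "resolvent S x - sc \<i> (S (resolvent S x)) = x"
proof -
  let ?y = "neumann S x"
  have lim: "(\<lambda>n. 2 * nrm x * (1/2) ^ n) \<longlonglongrightarrow> 0"
    by (rule LIMSEQ_abs_realpow_zero2[THEN tendsto_mult_right_zero]) simp
  have "\<exists>N. \<forall>m\<ge>N. \<forall>n\<ge>N. nrm (?y m - ?y n) < e" if "e > 0" for e
  proof -
    from LIMSEQ_D[OF lim, of "e/2"] that
    obtain N where N: "2 * nrm x * (1/2) ^ N < e / 2" by fastforce
    have *: "nrm (?y m - ?y N) < e / 2" if "m \<ge> N" for m
      using neumann_diff[of x N "m - N"] N that by simp
    have "nrm (?y m - ?y n) < e" if "m \<ge> N" "n \<ge> N" for m n
      using nrm_triangle_diff[of "?y m" "?y n" "?y N"] *[OF that(1)] *[OF that(2)]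
      by (simp add: nrm_minus_commute[of "?y N"])
    then show ?thesis by blast
  qed
  then obtain y where y: "(\<lambda>n. nrm (?y n - y)) \<longlonglongrightarrow> 0"
    using complete[of ?y] by blast
  have "(\<lambda>n. nrm (?y (Suc n) - y) + nrm (?y n - y)) \<longlonglongrightarrow> 0 + 0"
    by (intro tendsto_add y LIMSEQ_Suc[OF y])
  \<comment> \<open>Inserting the recursion for the iterate \<open>Suc n\<close> bounds the residual
    by two consecutive errors.\<close>
  moreover have "nrm (y - sc \<i> (S y) - x) \<le> nrm (?y (Suc n) - y) + nrm (?y n - y)" for n
  proof -
    have "y - sc \<i> (S y) - x = (y - ?y (Suc n)) + sc \<i> (S (?y n - y))"
      by (simp add: S_diff scale_right_diff_distrib)
    then have "nrm (y - sc \<i> (S y) - x) \<le> nrm (y - ?y (Suc n)) + nrm (S (?y n - y))"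
      using nrm_triangle nrm_scale[of \<i>] by (metis norm_ii mult_1)
    also have "\<dots> \<le> nrm (?y (Suc n) - y) + nrm (?y n - y)"
      using S_bound[of "?y n - y"] nrm_ge_0[of "?y n - y"]
      unfolding nrm_minus_commute[of y "?y (Suc n)"] by linarith
    finally show ?thesis .
  qed
  ultimately have "nrm (y - sc \<i> (S y) - x) \<le> 0 + 0"
    by (intro LIMSEQ_le_const[of _ "0 + 0"]) auto
  then have "y - sc \<i> (S y) - x = 0"
    using nrm_eq_0 nrm_ge_0 by (metis add_0 order_antisym)
  then have eq: "y - sc \<i> (S y) = x" by simp
  have "resolvent S x = y"
    unfolding resolvent_def
  proof (rule the_equality)
    show "z = y" if "z - sc \<i> (S z) = x" for z
      by (rule resolvent_unique) (simp only: eq that)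
  qed (rule eq)
  with y eq show "(\<lambda>n. nrm (?y n - resolvent S x)) \<longlonglongrightarrow> 0"
    "resolvent S x - sc \<i> (S (resolvent S x)) = x" by simp_all
qed

lemma resolventI: "y - sc \<i> (S y) = x \<Longrightarrow> resolvent S x = y"
  by (rule resolvent_unique) (simp only: resolvent_eq)

lemma resolvent_add: "resolvent S (x + y) = resolvent S x + resolvent S y"
proof (rule resolventI)
  show "resolvent S x + resolvent S y - sc \<i> (S (resolvent S x + resolvent S y)) = x + y"
    using resolvent_eq[of x] resolvent_eq[of y]
    by (metis S_add add_diff_add scale_right_distrib)
qed

lemma resolvent_scale: "resolvent S (sc a x) = sc a (resolvent S x)"
proof (rule resolventI)
  have "sc a (resolvent S x) - sc \<i> (S (sc a (resolvent S x)))
      = sc a (resolvent S x - sc \<i> (S (resolvent S x)))"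
    by (simp add: S_scale scale_right_diff_distrib mult.commute)
  then show "sc a (resolvent S x) - sc \<i> (S (sc a (resolvent S x))) = sc a x"
    by (simp only: resolvent_eq)
qed

lemma nrm_resolvent: "nrm (resolvent S x) \<le> nrm x"
proof (rule power2_le_imp_le)
  show "(nrm (resolvent S x))\<^sup>2 \<le> (nrm x)\<^sup>2"
    using nrm_shift_sq(1)[of "resolvent S x"] zero_le_power2[of "nrm (S (resolvent S x))"]
    unfolding resolvent_eq by linarith
qed simp

lemma cayley_eq: "cayley S x = resolvent S x + sc \<i> (S (resolvent S x))"
proof -
  have "cayley S x = sc 2 (resolvent S x) - (resolvent S x - sc \<i> (S (resolvent S x)))"
    by (simp add: cayley_def resolvent_eq)
  also have "sc 2 (resolvent S x) = resolvent S x + resolvent S x"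
    using scale_left_distrib[of 1 1 "resolvent S x"] by simp
  finally show ?thesis by simp
qed

lemma cayley_add: "cayley S (x + y) = cayley S x + cayley S y"
  by (simp add: cayley_def resolvent_add scale_right_distrib)

lemma cayley_scale: "cayley S (sc a x) = sc a (cayley S x)"
  by (simp add: cayley_def resolvent_scale scale_right_diff_distrib mult.commute)

text \<open>\<open>1 + \<i>S\<close> and \<open>1 - \<i>S\<close> give the vector
  \<open>resolvent S x\<close> images of equal norm, and the second image is
  \<open>x\<close>.\<close>

lemma nrm_cayley: "nrm (cayley S x) = nrm x"
proof -
  have "(nrm (cayley S x))\<^sup>2 = (nrm (resolvent S x - sc \<i> (S (resolvent S x))))\<^sup>2"
    by (simp only: cayley_eq nrm_shift_sq)
  then show ?thesis by (simp add: resolvent_eq power2_eq_iff_nonneg)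
qed

end

end

section \<open>Conjugations on the fibre space\<close>

locale hilbert_conjugation = hilbert_structure +
  fixes J
  assumes hconj: "hconj sc ip J"
begin

lemma
  shows J_add: "J (x + y) = J x + J y"
    and J_scale: "J (sc a x) = sc (cnj a) (J x)"
    and nrm_J [simp]: "nrm (J x) = nrm x"
    and J_J [simp]: "J (J x) = x"
  using hconj unfolding hconj_def by blast+

lemma J_diff: "J (x - y) = J x - J y"
  by (metis J_add add_diff_cancel diff_add_cancel)

lemma J_zero [simp]: "J 0 = 0"
  using J_diff[of 0 0] by simp

text \<open>Polarization handles the real part, as \<open>J\<close> is additive and isometric; the
  imaginary part changes sign because \<open>J\<close> turns \<open>\<i>\<close> into
  \<open>-\<i>\<close>.\<close>

lemma ip_J: "ip (J x) (J y) = cnj (ip x y)"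
proof -
  have Re: "Re (ip (J x) (J y)) = Re (ip x y)" for x y
    unfolding Re_ip_polar by (simp flip: J_add)
  have "Im (ip (J x) (J y)) = - Re (ip (J x) (J (sc \<i> y)))"
    unfolding Im_ip_eq J_scale by (simp add: ip_simps)
  then show ?thesis
    unfolding Re by (simp add: complex_eq_iff Re ip_simps)
qed

lemma ip_J_left: "ip (J x) y = cnj (ip x (J y))"
  using ip_J[of x "J y"] by simp

text \<open>If \<open>J S J = S'\<close>, conjugation by \<open>J\<close> flips the sign of \<open>\<i>\<close>, hence inverts the Cayley transform.\<close>

lemma J_cayley_J_cayley:
  assumes S: "selfadjoint_half S" and S': "selfadjoint_half S'"
    and conj: "\<And>x. J (S (J x)) = S' x"
  shows "J (cayley S' (J (cayley S x))) = x"
proof -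
  define y where "y = resolvent S x"
  have JS: "J (S y) = S' (J y)" using conj[of "J y"] by simp
  \<comment> \<open>This exhibits \<open>J (cayley S x)\<close> as the image of \<open>J y\<close>
    under \<open>1 - \<i>S'\<close>, so its resolvent for \<open>S'\<close> is
    \<open>J y\<close>.\<close>
  have z: "J (cayley S x) = J y - sc \<i> (S' (J y))"
    by (simp add: cayley_eq[OF S] y_def[symmetric] J_add J_scale JS scale_minus_left)
  have "resolvent S' (J (cayley S x)) = J y"
    by (rule resolventI[OF S']) (simp add: z)
  then have "J (cayley S' (J (cayley S x))) = J (J y + sc \<i> (J (S y)))"
    by (simp add: cayley_eq[OF S'] JS)
  also have "\<dots> = y - sc \<i> (S y)" by (simp add: J_add J_scale scale_minus_left)
  also have "\<dots> = x" unfolding y_def by (rule resolvent_eq[OF S])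
  finally show ?thesis .
qed

end

section \<open>Measures on the circle\<close>

locale circle_measure = finite_measure \<mu> for \<mu> :: "complex measure" +
  assumes sets_eq: "sets \<mu> = sets (restrict_space borel circle)"
    and ac: "absolutely_continuous \<mu> (distr \<mu> \<mu> cnj)"
begin

lemma space_eq: "space \<mu> = circle"
  using sets_eq_imp_space_eq[OF sets_eq] by (simp add: space_restrict_space)

lemma borel_measurable_restrict:
  "f \<in> borel_measurable borel \<Longrightarrow> f \<in> borel_measurable \<mu>"
  unfolding measurable_cong_sets[OF sets_eq refl] by (rule measurable_restrict_space1)

lemma cnj_measurable [measurable]: "cnj \<in> measurable \<mu> \<mu>"
proof -
  have "cnj \<in> restrict_space borel circle \<rightarrow>\<^sub>M restrict_space borel circle"
    by (rule measurable_restrict_space3) (simp_all add: borel_measurable_continuous_onI continuous_on_cnj)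
  then show ?thesis
    using measurable_cong_sets[OF sets_eq sets_eq] by blast
qed

lemma measurable_comp_cnj: "f \<in> measurable \<mu> M \<Longrightarrow> (\<lambda>\<xi>. f (cnj \<xi>)) \<in> measurable \<mu> M"
  by (rule measurable_compose[OF cnj_measurable])

text \<open>Absolute continuity makes the reflection of a null set null, so exceptional sets can be
  moved to conjugate points.\<close>

lemma AE_cnj:
  assumes "AE \<xi> in \<mu>. P \<xi>" shows "AE \<xi> in \<mu>. P (cnj \<xi>)"
  by (rule AE_distrD[OF cnj_measurable]) (rule absolutely_continuous_AE[OF sets_distr ac assms])

section \<open>The density of the reflected measure\<close>

definition h :: "complex \<Rightarrow> real" where
  "h \<xi> = enn2real (RN_deriv \<mu> (distr \<mu> \<mu> cnj) \<xi>)"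

lemma h_measurable [measurable]: "h \<in> borel_measurable \<mu>"
  unfolding h_def by measurable

lemma h_nonneg [simp]: "0 \<le> h \<xi>"
  by (simp add: h_def)

text \<open>The reflected measure is finite, so its Radon-Nikodym derivative is finite almost
  everywhere, and taking real values in \<open>h\<close> alters it only on a null set.\<close>

lemma density_h: "density \<mu> (\<lambda>\<xi>. ennreal (h \<xi>)) = distr \<mu> \<mu> cnj"
proof -
  interpret c: finite_measure "distr \<mu> \<mu> cnj"
    by (rule finite_measure_distr) simp
  have "AE \<xi> in \<mu>. RN_deriv \<mu> (distr \<mu> \<mu> cnj) \<xi> \<noteq> \<infinity>"
    by (intro RN_deriv_finite c.sigma_finite_measure_axioms ac) simp
  then have "AE \<xi> in \<mu>. ennreal (h \<xi>) = RN_deriv \<mu> (distr \<mu> \<mu> cnj) \<xi>"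
    by eventually_elim (simp add: h_def less_top)
  then have "density \<mu> (\<lambda>\<xi>. ennreal (h \<xi>)) = density \<mu> (RN_deriv \<mu> (distr \<mu> \<mu> cnj))"
    by (intro density_cong) auto
  then show ?thesis
    using density_RN_deriv[OF ac] by simp
qed

lemma nn_integral_cnj:
  assumes [measurable]: "g \<in> borel_measurable \<mu>"
  shows "(\<integral>\<^sup>+\<xi>. g (cnj \<xi>) \<partial>\<mu>) = (\<integral>\<^sup>+\<xi>. ennreal (h \<xi>) * g \<xi> \<partial>\<mu>)"
proof -
  have "(\<integral>\<^sup>+\<xi>. g (cnj \<xi>) \<partial>\<mu>) = integral\<^sup>N (distr \<mu> \<mu> cnj) g"
    by (simp add: nn_integral_distr)
  then show ?thesis
    unfolding density_h[symmetric] by (simp add: nn_integral_density)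
qed

text \<open>Reflecting twice is the identity, so the product is a density of \<open>\<mu>\<close>
  with respect to itself; such densities are unique almost everywhere.\<close>

lemma h_cnj: "AE \<xi> in \<mu>. h \<xi> * h (cnj \<xi>) = 1"
proof -
  have "AE \<xi> in \<mu>. ennreal (h \<xi>) * ennreal (h (cnj \<xi>)) = 1"
  proof (rule density_unique_finite_measure)
    fix A assume [measurable]: "A \<in> sets \<mu>"
    have "(\<integral>\<^sup>+\<xi>. ennreal (h \<xi>) * ennreal (h (cnj \<xi>)) * indicator A \<xi> \<partial>\<mu>)
        = (\<integral>\<^sup>+\<xi>. ennreal (h \<xi>) * indicator A (cnj \<xi>) \<partial>\<mu>)"
      using nn_integral_cnj[of "\<lambda>\<xi>. ennreal (h (cnj \<xi>)) * indicator A \<xi>"] by (simp add: mult.assoc)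
    also have "\<dots> = (\<integral>\<^sup>+\<xi>. indicator A \<xi> \<partial>\<mu>)"
      using nn_integral_cnj[of "\<lambda>\<xi>. indicator A (cnj \<xi>)"] by simp
    finally show "(\<integral>\<^sup>+\<xi>. ennreal (h \<xi>) * ennreal (h (cnj \<xi>)) * indicator A \<xi> \<partial>\<mu>)
        = (\<integral>\<^sup>+\<xi>. 1 * indicator A \<xi> \<partial>\<mu>)" by simp
  qed auto
  then show ?thesis
    by eventually_elim (simp flip: ennreal_mult ennreal_1)
qed

text \<open>Integrating the reflected \<open>g\<close> against the reflected measure makes the two
  reflections cancel. This is the scalar form of the isometry of \<open>J#\<close>.\<close>

lemma integrable_h_cnj:
  fixes g :: "complex \<Rightarrow> real"
  assumes g: "integrable \<mu> g"
  shows "integrable \<mu> (\<lambda>\<xi>. h \<xi> * g (cnj \<xi>))"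
    and "(\<integral>\<xi>. h \<xi> * g (cnj \<xi>) \<partial>\<mu>) = (\<integral>\<xi>. g \<xi> \<partial>\<mu>)"
proof -
  have [measurable]: "g \<in> borel_measurable \<mu>" using g by simp
  have gc: "(\<lambda>\<xi>. g (cnj \<xi>)) \<in> borel_measurable \<mu>" by measurable
  have "integrable (distr \<mu> \<mu> cnj) (\<lambda>\<xi>. g (cnj \<xi>))"
    using g by (subst integrable_distr_eq) auto
  then show "integrable \<mu> (\<lambda>\<xi>. h \<xi> * g (cnj \<xi>))"
    unfolding density_h[symmetric] using gc by (subst (asm) integrable_density) auto
  have "(\<integral>\<xi>. g (cnj \<xi>) \<partial>distr \<mu> \<mu> cnj) = (\<integral>\<xi>. g \<xi> \<partial>\<mu>)"
    by (subst integral_distr) auto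
  then show "(\<integral>\<xi>. h \<xi> * g (cnj \<xi>) \<partial>\<mu>) = (\<integral>\<xi>. g \<xi> \<partial>\<mu>)"
    unfolding density_h[symmetric] using gc by (subst (asm) integral_density) auto
qed

section \<open>Testing integrable functions against real polynomials\<close>

lemma continuous_on_real_polynomial:
  "real_polynomial_function p \<Longrightarrow> continuous_on S (p :: complex \<Rightarrow> real)"
  using continuous_real_polymonial_function continuous_at_imp_continuous_on by blast

lemma real_polynomial_function_bounded:
  fixes p :: "complex \<Rightarrow> real"
  assumes "real_polynomial_function p"
  obtains B where "\<And>\<xi>. \<xi> \<in> circle \<Longrightarrow> \<bar>p \<xi>\<bar> \<le> B"
proof -
  have "bounded (p ` circle)"
    by (intro compact_imp_bounded compact_continuous_image continuous_on_real_polynomial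
        assms compact_sphere)
  then obtain B where "\<forall>x\<in>circle. \<bar>p x\<bar> \<le> B" by (auto simp: bounded_iff)
  then show ?thesis using that[of B] by blast
qed

lemma real_polynomial_function_measurable:
  fixes p :: "complex \<Rightarrow> real"
  assumes "real_polynomial_function p"
  shows "p \<in> borel_measurable \<mu>"
  by (intro borel_measurable_restrict borel_measurable_continuous_onI
      continuous_on_real_polynomial assms)

lemma integrable_bounded_mult:
  fixes \<phi> \<psi> :: "complex \<Rightarrow> real"
  assumes "integrable \<mu> \<phi>" "\<psi> \<in> borel_measurable \<mu>" "\<And>\<xi>. \<xi> \<in> circle \<Longrightarrow> \<bar>\<psi> \<xi>\<bar> \<le> B"
  shows "integrable \<mu> (\<lambda>\<xi>. \<psi> \<xi> * \<phi> \<xi>)"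
proof (rule Bochner_Integration.integrable_bound)
  show "integrable \<mu> (\<lambda>\<xi>. B * \<phi> \<xi>)" using assms(1) by simp
  show "(\<lambda>\<xi>. \<psi> \<xi> * \<phi> \<xi>) \<in> borel_measurable \<mu>"
    using assms(1,2) by simp
  have "\<bar>\<psi> \<xi>\<bar> * \<bar>\<phi> \<xi>\<bar> \<le> \<bar>B\<bar> * \<bar>\<phi> \<xi>\<bar>" if "\<xi> \<in> circle" for \<xi>
    using assms(3)[OF that] by (intro mult_right_mono) auto
  then show "AE \<xi> in \<mu>. norm (\<psi> \<xi> * \<phi> \<xi>) \<le> norm (B * \<phi> \<xi>)"
    by (intro AE_I2) (simp add: abs_mult space_eq)
qed

text \<open>Orthogonality passes to bounded continuous functions by Stone-Weierstrass on the compact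
  circle, to closed sets by dominated convergence, and to Borel sets because the closed sets are an
  intersection-stable generator. Vanishing integrals over all measurable sets force the function to
  vanish.\<close>

lemma AE_zero_if_orthogonal_to_polynomials:
  assumes \<phi>: "integrable \<mu> \<phi>"
    and orth: "\<And>p. real_polynomial_function p \<Longrightarrow> (\<integral>\<xi>. p \<xi> * \<phi> \<xi> \<partial>\<mu>) = 0"
  shows "AE \<xi> in \<mu>. \<phi> \<xi> = (0::real)"
proof -
  have [measurable]: "\<phi> \<in> borel_measurable \<mu>" using \<phi> by simp
  have cont: "(\<integral>\<xi>. \<psi> \<xi> * \<phi> \<xi> \<partial>\<mu>) = 0"
    if \<psi>: "continuous_on UNIV \<psi>" and B: "\<And>\<xi>. \<bar>\<psi> \<xi>\<bar> \<le> B" for \<psi> :: "complex \<Rightarrow> real" and B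
  proof -
    have [measurable]: "\<psi> \<in> borel_measurable \<mu>"
      by (intro borel_measurable_restrict borel_measurable_continuous_onI \<psi>)
    let ?I = "\<integral>\<xi>. \<bar>\<phi> \<xi>\<bar> \<partial>\<mu>"
    \<comment> \<open>Replacing \<open>\<psi>\<close> by a uniformly \<open>e\<close>-close
      polynomial costs at most \<open>e\<close> times the integral of the modulus of
      \<open>\<phi>\<close>; afterwards \<open>e\<close> tends to 0.\<close>
    have "\<bar>\<integral>\<xi>. \<psi> \<xi> * \<phi> \<xi> \<partial>\<mu>\<bar> \<le> e * ?I" if "e > 0" for e
    proof -
      obtain p where p: "real_polynomial_function p" "\<And>\<xi>. \<xi> \<in> circle \<Longrightarrow> \<bar>\<psi> \<xi> - p \<xi>\<bar> < e"
        by (rule Stone_Weierstrass_real_polynomial_function[of circle \<psi> e])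
           (auto simp: \<open>e > 0\<close> intro: continuous_on_subset[OF \<psi>])
      note [measurable] = real_polynomial_function_measurable[OF p(1)]
      obtain B' where B': "\<And>\<xi>. \<xi> \<in> circle \<Longrightarrow> \<bar>p \<xi>\<bar> \<le> B'"
        using real_polynomial_function_bounded[OF p(1)] by blast
      have int: "integrable \<mu> (\<lambda>\<xi>. \<psi> \<xi> * \<phi> \<xi>)" "integrable \<mu> (\<lambda>\<xi>. p \<xi> * \<phi> \<xi>)"
        by (rule integrable_bounded_mult[OF \<phi> _ B], simp)
           (rule integrable_bounded_mult[OF \<phi> _ B'], simp_all)
      have "(\<integral>\<xi>. \<psi> \<xi> * \<phi> \<xi> \<partial>\<mu>) = (\<integral>\<xi>. \<psi> \<xi> * \<phi> \<xi> - p \<xi> * \<phi> \<xi> \<partial>\<mu>)"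
        using int orth[OF p(1)] by simp
      also have "\<bar>\<dots>\<bar> \<le> (\<integral>\<xi>. e * \<bar>\<phi> \<xi>\<bar> \<partial>\<mu>)"
      proof (rule integral_abs_bound[THEN order_trans], rule integral_mono)
        show "\<bar>\<psi> \<xi> * \<phi> \<xi> - p \<xi> * \<phi> \<xi>\<bar> \<le> e * \<bar>\<phi> \<xi>\<bar>" if "\<xi> \<in> space \<mu>" for \<xi>
          using p(2)[of \<xi>] that
          by (simp add: space_eq abs_mult mult_right_mono flip: left_diff_distrib)
      qed (use int \<phi> in auto)
      finally show ?thesis by simp
    qed
    then have "\<forall>\<^sub>F e in at_right 0. \<bar>\<integral>\<xi>. \<psi> \<xi> * \<phi> \<xi> \<partial>\<mu>\<bar> \<le> e * ?I"
      by (auto simp: eventually_at_right_less intro: eventually_mono[OF eventually_at_right_less])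
    moreover have "((\<lambda>e. e * ?I) \<longlongrightarrow> 0 * ?I) (at_right 0)"
      by (intro tendsto_intros)
    ultimately have "\<bar>\<integral>\<xi>. \<psi> \<xi> * \<phi> \<xi> \<partial>\<mu>\<bar> \<le> 0 * ?I"
      using tendsto_lowerbound trivial_limit_at_right_real by blast
    then show ?thesis by simp
  qed
  have bm: "(indicator A :: _ \<Rightarrow> real) \<in> borel_measurable \<mu>" if "A \<in> sets borel" for A :: "complex set"
    using that by (intro borel_measurable_restrict) simp
  have intA: "integrable \<mu> (\<lambda>\<xi>. indicator A \<xi> * \<phi> \<xi>)" if "A \<in> sets borel" for A
    using that by (intro integrable_bounded_mult[of _ _ 1] \<phi> bm) (auto simp: indicator_def)
  have stable: "Int_stable (Collect (closed :: complex set \<Rightarrow> bool))"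
    by (auto simp: Int_stable_def)
  have Pow: "Collect (closed :: complex set \<Rightarrow> bool) \<subseteq> Pow UNIV" by simp
  have "(\<integral>\<xi>. indicator A \<xi> * \<phi> \<xi> \<partial>\<mu>) = 0"
    if "A \<in> sigma_sets UNIV (Collect closed)" for A
    using stable Pow that
  proof (induction rule: sigma_sets_induct_disjoint)
    case (basic A)
    show ?case
    proof (cases "A = {}")
      case False
      \<comment> \<open>A continuous cutoff, equal to 1 on \<open>A\<close> and, for positive
        \<open>n\<close>, to 0 from distance \<open>1/n\<close> on; it tends to the indicator
        because \<open>A\<close> is closed. The empty set is treated apart since
        \<open>infdist\<close> to it is 0.\<close>
      define \<psi> where "\<psi> n \<xi> = max 0 (1 - real n * infdist \<xi> A)" for n \<xi>
      have \<psi>: "continuous_on UNIV (\<psi> n)" for n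
        unfolding \<psi>_def by (intro continuous_intros)
      have B: "\<bar>\<psi> n \<xi>\<bar> \<le> 1" for n \<xi>
        unfolding \<psi>_def by (simp add: infdist_nonneg)
      have [measurable]: "\<psi> n \<in> borel_measurable \<mu>" for n
        by (intro borel_measurable_restrict borel_measurable_continuous_onI \<psi>)
      have lim: "(\<lambda>n. \<psi> n \<xi>) \<longlonglongrightarrow> indicator A \<xi>" for \<xi>
      proof (cases "\<xi> \<in> A")
        case True
        then show ?thesis by (simp add: \<psi>_def)
      next
        case notin: False
        then have pos: "infdist \<xi> A > 0"
          using in_closed_iff_infdist_zero[of A \<xi>] basic False infdist_nonneg[of \<xi> A] by force
        obtain N where N: "1 / infdist \<xi> A < real N" using reals_Archimedean2 by blast
        have "\<psi> n \<xi> = 0" if "n \<ge> N" for n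
        proof -
          have "1 / infdist \<xi> A < real n" using N that by linarith
          then show ?thesis using pos by (simp add: \<psi>_def field_simps)
        qed
        then show ?thesis
          using notin by (intro tendsto_eventually) (auto simp: eventually_sequentially)
      qed
      have "(\<lambda>n. \<integral>\<xi>. \<psi> n \<xi> * \<phi> \<xi> \<partial>\<mu>) \<longlonglongrightarrow> (\<integral>\<xi>. indicator A \<xi> * \<phi> \<xi> \<partial>\<mu>)"
      proof (rule integral_dominated_convergence)
        show "integrable \<mu> (\<lambda>\<xi>. \<bar>\<phi> \<xi>\<bar>)" using \<phi> by simp
        show "AE \<xi> in \<mu>. (\<lambda>n. \<psi> n \<xi> * \<phi> \<xi>) \<longlonglongrightarrow> indicator A \<xi> * \<phi> \<xi>"
          by (intro AE_I2 tendsto_mult lim tendsto_const)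
        show "AE \<xi> in \<mu>. norm (\<psi> n \<xi> * \<phi> \<xi>) \<le> \<bar>\<phi> \<xi>\<bar>" for n
          using B[of n] by (intro AE_I2) (simp add: abs_mult mult_left_le_one_le)
      qed (use bm[of A] basic in auto)
      then show ?thesis
        using cont[OF \<psi> B] by (simp add: LIMSEQ_const_iff)
    qed simp
  next
    case (compl A)
    \<comment> \<open>The whole circle contributes 0, as the constant 1 is a polynomial.\<close>
    have "(\<integral>\<xi>. indicator (UNIV - A) \<xi> * \<phi> \<xi> \<partial>\<mu>)
        = (\<integral>\<xi>. 1 * \<phi> \<xi> - indicator A \<xi> * \<phi> \<xi> \<partial>\<mu>)"
      by (intro Bochner_Integration.integral_cong) (auto simp: indicator_def)
    moreover have "A \<in> sets borel" using compl(1) by (simp add: borel_eq_closed sets_measure_of)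
    ultimately show ?case
      using compl intA[of A] \<phi> orth[of "\<lambda>_. 1"] by auto
  next
    case (union A)
    have "A i \<in> sets borel" for i
      using union(2) by (auto simp: borel_eq_closed sets_measure_of)
    \<comment> \<open>The \<open>A i\<close> are Borel in the plane, while the measurable sets of
      \<open>\<mu>\<close> lie in the circle.\<close>
    then have A: "A i \<inter> circle \<in> sets \<mu>" for i
      unfolding sets_eq sets_restrict_space by auto
    have restrict: "(\<integral>\<xi>. indicator B \<xi> * \<phi> \<xi> \<partial>\<mu>) = (LINT \<xi>:B \<inter> circle|\<mu>. \<phi> \<xi>)" for B
      unfolding set_lebesgue_integral_def
      by (intro Bochner_Integration.integral_cong) (auto simp: indicator_def space_eq)
    have "(LINT \<xi>:(\<Union>i. A i \<inter> circle)|\<mu>. \<phi> \<xi>) = (\<Sum>i. LINT \<xi>:A i \<inter> circle|\<mu>. \<phi> \<xi>)"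
    proof (rule lebesgue_integral_countable_add)
      show "(A i \<inter> circle) \<inter> (A j \<inter> circle) = {}" if "i \<noteq> j" for i j
        using union(1) that by (auto simp: disjoint_family_on_def)
      show "set_integrable \<mu> (\<Union>i. A i \<inter> circle) \<phi>"
        unfolding set_integrable_def using A
        by (intro integrable_mult_indicator \<phi> sets.countable_UN) auto
    qed (rule A)
    then show ?case
      using union(3) \<open>\<And>i. A i \<in> sets borel\<close> unfolding restrict by simp
  qed simp_all
  then have borel0: "(\<integral>\<xi>. indicator A \<xi> * \<phi> \<xi> \<partial>\<mu>) = 0" if "A \<in> sets borel" for A
    using that by (simp add: borel_eq_closed sets_measure_of)
  have "(LINT \<xi>:A|\<mu>. \<phi> \<xi>) = 0" if "A \<in> sets \<mu>" for A
  proof -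
    have "A \<in> (\<inter>) circle ` sets borel"
      using that unfolding sets_eq sets_restrict_space .
    then obtain B where B: "A = circle \<inter> B" "B \<in> sets borel" by (rule imageE)
    have "(LINT \<xi>:A|\<mu>. \<phi> \<xi>) = (\<integral>\<xi>. indicator B \<xi> * \<phi> \<xi> \<partial>\<mu>)"
      unfolding set_lebesgue_integral_def B(1)
      by (intro Bochner_Integration.integral_cong) (auto simp: indicator_def space_eq)
    then show ?thesis using borel0[OF B(2)] by simp
  qed
  then show ?thesis
    by (intro density_zero \<phi>)
qed

end

section \<open>Vector-valued square-integrable functions\<close>

context hilbert_structure begin

section \<open>Weak measurability of vector-valued functions\<close>

lemma borel_measurable_ip: "hmeasurable ip M f \<Longrightarrow> (\<lambda>\<xi>. ip (f \<xi>) e) \<in> borel_measurable M"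
  by (simp add: hmeasurable_def)

lemma hmeasurableI: "(\<And>e. (\<lambda>\<xi>. ip (f \<xi>) e) \<in> borel_measurable M) \<Longrightarrow> hmeasurable ip M f"
  by (simp add: hmeasurable_def)

lemma hmeasurable_const: "hmeasurable ip M (\<lambda>_. x)"
  by (rule hmeasurableI) simp

lemma hmeasurable_add:
  "hmeasurable ip M f \<Longrightarrow> hmeasurable ip M g \<Longrightarrow> hmeasurable ip M (\<lambda>\<xi>. f \<xi> + g \<xi>)"
  by (rule hmeasurableI) (simp add: ip_simps borel_measurable_add borel_measurable_diff
      borel_measurable_times borel_measurable_ip)

lemma hmeasurable_diff:
  "hmeasurable ip M f \<Longrightarrow> hmeasurable ip M g \<Longrightarrow> hmeasurable ip M (\<lambda>\<xi>. f \<xi> - g \<xi>)"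
  by (rule hmeasurableI) (simp add: ip_simps borel_measurable_add borel_measurable_diff
      borel_measurable_times borel_measurable_ip)

lemma hmeasurable_scale:
  "a \<in> borel_measurable M \<Longrightarrow> hmeasurable ip M f \<Longrightarrow> hmeasurable ip M (\<lambda>\<xi>. sc (a \<xi>) (f \<xi>))"
  by (rule hmeasurableI) (simp add: ip_simps borel_measurable_add borel_measurable_diff
      borel_measurable_times borel_measurable_ip)

text \<open>\<open>\<parallel>x\<parallel>\<^sup>2\<close> is the supremum of \<open>2 Re \<langle>x,d\<rangle> - \<parallel>d\<parallel>\<^sup>2\<close> over a countable dense set,
  because \<open>\<parallel>x - d\<parallel>\<^sup>2 \<ge> 0\<close> gets arbitrarily small.\<close>

lemma borel_measurable_nrm:
  assumes f: "hmeasurable ip M f"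
  shows "(\<lambda>\<xi>. nrm (f \<xi>)) \<in> borel_measurable M"
proof -
  obtain d :: "nat \<Rightarrow> 'h" where d: "\<And>x e. e > 0 \<Longrightarrow> \<exists>k. nrm (x - d k) < e"
    using dense_sequence by blast
  define t where "t x k = 2 * Re (ip x (d k)) - (nrm (d k))\<^sup>2" for x k
  have t: "t x k = (nrm x)\<^sup>2 - (nrm (x - d k))\<^sup>2" for x k
    by (simp add: t_def nrm_diff_sq)
  have "(SUP k. t x k) = (nrm x)\<^sup>2" for x
  proof (rule cSup_eq)
    show "y \<le> (nrm x)\<^sup>2" if "y \<in> range (t x)" for y
      using that by (auto simp: t)
    show "(nrm x)\<^sup>2 \<le> y" if y: "\<And>z. z \<in> range (t x) \<Longrightarrow> z \<le> y" for y
    proof (rule field_le_epsilon)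
      fix e :: real assume "e > 0"
      then obtain k where "nrm (x - d k) < sqrt e" using d[of "sqrt e" x] by auto
      then have "(nrm (x - d k))\<^sup>2 \<le> (sqrt e)\<^sup>2"
        by (intro power_mono) auto
      then show "(nrm x)\<^sup>2 \<le> y + e"
        using y[of "t x k"] \<open>e > 0\<close> by (simp add: t)
    qed
  qed
  moreover have "(\<lambda>\<xi>. SUP k. t (f \<xi>) k) \<in> borel_measurable M"
  proof (rule borel_measurable_cSUP)
    show "(\<lambda>\<xi>. t (f \<xi>) k) \<in> borel_measurable M" for k
      unfolding t_def using borel_measurable_ip[OF f, of "d k"] by simp
    show "bdd_above (range (t (f \<xi>)))" for \<xi>
      by (rule bdd_aboveI[of _ "(nrm (f \<xi>))\<^sup>2"]) (auto simp: t)
  qed simp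
  ultimately have "(\<lambda>\<xi>. (nrm (f \<xi>))\<^sup>2) \<in> borel_measurable M" by simp
  then have "(\<lambda>\<xi>. sqrt ((nrm (f \<xi>))\<^sup>2)) \<in> borel_measurable M" by measurable
  then show ?thesis by simp
qed

text \<open>Approximating \<open>f \<xi>\<close> by the first member of a dense sequence within distance \<open>1/(n+1)\<close>
  reduces the measurability of a composition to countably many sections.\<close>

lemma borel_measurable_caratheodory:
  fixes G :: "complex \<Rightarrow> 'h \<Rightarrow> complex"
  assumes f: "hmeasurable ip M f"
    and G: "\<And>x. (\<lambda>\<xi>. G \<xi> x) \<in> borel_measurable M"
    and lip: "\<And>\<xi> x y. \<xi> \<in> space M \<Longrightarrow> cmod (G \<xi> x - G \<xi> y) \<le> B \<xi> * nrm (x - y)"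
  shows "(\<lambda>\<xi>. G \<xi> (f \<xi>)) \<in> borel_measurable M"
proof -
  obtain d :: "nat \<Rightarrow> 'h" where d: "\<And>x e. e > 0 \<Longrightarrow> \<exists>k. nrm (x - d k) < e"
    using dense_sequence by blast
  define k where "k n \<xi> = (LEAST k. nrm (f \<xi> - d k) < inverse (real (Suc n)))" for n \<xi>
  have close: "nrm (f \<xi> - d (k n \<xi>)) < inverse (real (Suc n))" for n \<xi>
    unfolding k_def by (rule LeastI_ex) (rule d, simp)
  have [measurable]: "(\<lambda>\<xi>. nrm (f \<xi> - d j)) \<in> borel_measurable M" for j
    by (intro borel_measurable_nrm hmeasurable_diff f hmeasurable_const)
  have k: "k n \<in> measurable M (count_space UNIV)" for n
    unfolding k_def by measurable
  have "(\<lambda>\<xi>. G \<xi> (d (k n \<xi>))) \<in> borel_measurable M" for n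
    by (rule measurable_compose_countable[OF G k])
  moreover have "(\<lambda>n. G \<xi> (d (k n \<xi>))) \<longlonglongrightarrow> G \<xi> (f \<xi>)" if \<xi>: "\<xi> \<in> space M" for \<xi>
  proof -
    have "(\<lambda>n. G \<xi> (d (k n \<xi>)) - G \<xi> (f \<xi>)) \<longlonglongrightarrow> 0"
    proof (rule Lim_null_comparison)
      have "cmod (G \<xi> (d (k n \<xi>)) - G \<xi> (f \<xi>)) \<le> \<bar>B \<xi>\<bar> * inverse (real (Suc n))" for n
      proof -
        have "cmod (G \<xi> (d (k n \<xi>)) - G \<xi> (f \<xi>)) \<le> B \<xi> * nrm (f \<xi> - d (k n \<xi>))"
          using lip[OF \<xi>, of "d (k n \<xi>)" "f \<xi>"] by (simp add: nrm_minus_commute)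
        also have "\<dots> \<le> \<bar>B \<xi>\<bar> * inverse (real (Suc n))"
          using close[of \<xi> n] by (intro mult_mono) auto
        finally show ?thesis .
      qed
      then show "\<forall>\<^sub>F n in sequentially. norm (G \<xi> (d (k n \<xi>)) - G \<xi> (f \<xi>))
          \<le> \<bar>B \<xi>\<bar> * inverse (real (Suc n))" by simp
      show "(\<lambda>n. \<bar>B \<xi>\<bar> * inverse (real (Suc n))) \<longlonglongrightarrow> 0"
        by (rule tendsto_mult_right_zero[OF LIMSEQ_inverse_real_of_nat])
    qed
    then show ?thesis by (simp add: LIM_zero_iff)
  qed
  ultimately show ?thesis
    by (rule borel_measurable_LIMSEQ_metric)
qed

text \<open>A bounded linear operator is Lipschitz, with a constant that may vary with the point, so
  the preceding criterion applies to each \<open>ip (F \<xi> x) e\<close>.\<close>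

lemma hmeasurable_apply:
  assumes f: "hmeasurable ip M f"
    and lin: "\<And>\<xi>. \<xi> \<in> space M \<Longrightarrow> hbounded_linear sc ip (F \<xi>)"
    and F: "\<And>x y. (\<lambda>\<xi>. ip (F \<xi> x) y) \<in> borel_measurable M"
  shows "hmeasurable ip M (\<lambda>\<xi>. F \<xi> (f \<xi>))"
proof (rule hmeasurableI)
  fix e
  have "\<forall>\<xi>\<in>space M. \<exists>B. \<forall>x. nrm (F \<xi> x) \<le> B * nrm x"
    using lin by (auto simp: hbounded_linear_def)
  then obtain B where B: "\<And>\<xi> x. \<xi> \<in> space M \<Longrightarrow> nrm (F \<xi> x) \<le> B \<xi> * nrm x" by metis
  show "(\<lambda>\<xi>. ip (F \<xi> (f \<xi>)) e) \<in> borel_measurable M"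
  proof (rule borel_measurable_caratheodory[OF f F])
    fix \<xi> x y assume \<xi>: "\<xi> \<in> space M"
    have "F \<xi> (x - y + y) = F \<xi> (x - y) + F \<xi> y"
      using lin[OF \<xi>] unfolding hbounded_linear_def by blast
    then have "ip (F \<xi> x) e - ip (F \<xi> y) e = ip (F \<xi> (x - y)) e"
      by (simp add: ip_simps)
    also have "cmod \<dots> \<le> nrm (F \<xi> (x - y)) * nrm e" by (rule Cauchy_Schwarz)
    also have "\<dots> \<le> (B \<xi> * nrm (x - y)) * nrm e"
      by (intro mult_right_mono B \<xi> nrm_ge_0)
    finally show "cmod (ip (F \<xi> x) e - ip (F \<xi> y) e) \<le> B \<xi> * nrm e * nrm (x - y)"
      by (simp add: mult_ac)
  qed
qed

section \<open>Square-integrable functions\<close>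

lemma L2_I:
  assumes "hmeasurable ip M f" "integrable M (\<lambda>\<xi>. (nrm (f \<xi>))\<^sup>2)" shows "f \<in> L2 ip M"
  using assms by (simp add: L2_def)

lemma L2_hmeasurable: "f \<in> L2 ip M \<Longrightarrow> hmeasurable ip M f"
  and L2_integrable: "f \<in> L2 ip M \<Longrightarrow> integrable M (\<lambda>\<xi>. (nrm (f \<xi>))\<^sup>2)"
  by (simp_all add: L2_def)

lemma L2_bounded:
  assumes f: "f \<in> L2 ip M" and g: "hmeasurable ip M g"
    and le: "AE \<xi> in M. nrm (g \<xi>) \<le> B * nrm (f \<xi>)"
  shows "g \<in> L2 ip M"
proof (rule L2_I[OF g])
  have "integrable M (\<lambda>\<xi>. B\<^sup>2 * (nrm (f \<xi>))\<^sup>2)" using L2_integrable[OF f] by simp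
  then show "integrable M (\<lambda>\<xi>. (nrm (g \<xi>))\<^sup>2)"
  proof (rule Bochner_Integration.integrable_bound)
    show "(\<lambda>\<xi>. (nrm (g \<xi>))\<^sup>2) \<in> borel_measurable M"
      using borel_measurable_nrm[OF g] by simp
    show "AE \<xi> in M. norm ((nrm (g \<xi>))\<^sup>2) \<le> norm (B\<^sup>2 * (nrm (f \<xi>))\<^sup>2)"
      using le by eventually_elim (simp add: power_mono flip: power_mult_distrib)
  qed
qed

lemma L2_scale_bounded:
  assumes f: "f \<in> L2 ip M" and a: "a \<in> borel_measurable M" "\<And>\<xi>. \<xi> \<in> space M \<Longrightarrow> cmod (a \<xi>) \<le> B"
  shows "(\<lambda>\<xi>. sc (a \<xi>) (f \<xi>)) \<in> L2 ip M"
  by (rule L2_bounded[OF f hmeasurable_scale[OF a(1) L2_hmeasurable[OF f]]])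
     (auto simp: nrm_scale intro!: mult_right_mono a)

lemma L2_scale: "f \<in> L2 ip M \<Longrightarrow> (\<lambda>\<xi>. sc a (f \<xi>)) \<in> L2 ip M"
  by (rule L2_scale_bounded) auto

lemma L2_add:
  assumes f: "f \<in> L2 ip M" and g: "g \<in> L2 ip M"
  shows "(\<lambda>\<xi>. f \<xi> + g \<xi>) \<in> L2 ip M"
proof (rule L2_I)
  show m: "hmeasurable ip M (\<lambda>\<xi>. f \<xi> + g \<xi>)"
    by (intro hmeasurable_add L2_hmeasurable f g)
  have "integrable M (\<lambda>\<xi>. 2 * (nrm (f \<xi>))\<^sup>2 + 2 * (nrm (g \<xi>))\<^sup>2)"
    using L2_integrable[OF f] L2_integrable[OF g] by simp
  then show "integrable M (\<lambda>\<xi>. (nrm (f \<xi> + g \<xi>))\<^sup>2)"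
    by (rule Bochner_Integration.integrable_bound)
       (use borel_measurable_nrm[OF m] nrm_add_sq_le in auto)
qed

lemma L2_diff: "f \<in> L2 ip M \<Longrightarrow> g \<in> L2 ip M \<Longrightarrow> (\<lambda>\<xi>. f \<xi> - g \<xi>) \<in> L2 ip M"
  using L2_add[of f M "\<lambda>\<xi>. sc (-1) (g \<xi>)"] L2_scale[of g M "-1"] by simp

lemma l2norm_sq: "(l2norm ip M f)\<^sup>2 = (\<integral>\<xi>. (nrm (f \<xi>))\<^sup>2 \<partial>M)"
  by (simp add: l2norm_def)

end

locale vector_L2 = hilbert_structure sc ip + circle_measure \<mu>
  for sc :: "complex \<Rightarrow> 'h::ab_group_add \<Rightarrow> 'h" and ip :: "'h \<Rightarrow> 'h \<Rightarrow> complex" and \<mu>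
begin

lemma L2_const: "(\<lambda>_. x) \<in> L2 ip \<mu>"
  by (rule L2_I[OF hmeasurable_const]) simp

lemma L2_mult_id: "f \<in> L2 ip \<mu> \<Longrightarrow> (\<lambda>\<xi>. sc \<xi> (f \<xi>)) \<in> L2 ip \<mu>"
  by (rule L2_scale_bounded[where B = 1])
     (auto simp: space_eq intro: borel_measurable_restrict)

lemma L2_mult_cnj: "f \<in> L2 ip \<mu> \<Longrightarrow> (\<lambda>\<xi>. sc (cnj \<xi>) (f \<xi>)) \<in> L2 ip \<mu>"
  by (rule L2_scale_bounded[where B = 1])
     (auto simp: space_eq intro!: borel_measurable_restrict borel_measurable_continuous_onI continuous_intros)

lemma L2_mult_polynomial:
  assumes f: "f \<in> L2 ip \<mu>" and p: "real_polynomial_function p"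
  shows "(\<lambda>\<xi>. sc (of_real (p \<xi>)) (f \<xi>)) \<in> L2 ip \<mu>"
proof -
  obtain B where "\<And>\<xi>. \<xi> \<in> circle \<Longrightarrow> \<bar>p \<xi>\<bar> \<le> B"
    using real_polynomial_function_bounded[OF p] by blast
  then show ?thesis
    using real_polynomial_function_measurable[OF p]
    by (intro L2_scale_bounded[OF f, where B = B]) (auto simp: space_eq)
qed

section \<open>Isometries commuting with multiplication by \<open>\<xi>\<close>\<close>

context
  fixes U :: "(complex \<Rightarrow> 'h) \<Rightarrow> complex \<Rightarrow> 'h"
  assumes U_L2: "\<And>f. f \<in> L2 ip \<mu> \<Longrightarrow> U f \<in> L2 ip \<mu>"
    and U_cong: "\<And>f g. f \<in> L2 ip \<mu> \<Longrightarrow> g \<in> L2 ip \<mu> \<Longrightarrow> (AE \<xi> in \<mu>. f \<xi> = g \<xi>)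
      \<Longrightarrow> AE \<xi> in \<mu>. U f \<xi> = U g \<xi>"
    and U_add: "\<And>f g. f \<in> L2 ip \<mu> \<Longrightarrow> g \<in> L2 ip \<mu> \<Longrightarrow> AE \<xi> in \<mu>. U (\<lambda>\<xi>. f \<xi> + g \<xi>) \<xi> = U f \<xi> + U g \<xi>"
    and U_scale: "\<And>a f. f \<in> L2 ip \<mu> \<Longrightarrow> AE \<xi> in \<mu>. U (\<lambda>\<xi>. sc a (f \<xi>)) \<xi> = sc a (U f \<xi>)"
    and U_norm: "\<And>f. f \<in> L2 ip \<mu> \<Longrightarrow> (\<integral>\<xi>. (nrm (U f \<xi>))\<^sup>2 \<partial>\<mu>) = (\<integral>\<xi>. (nrm (f \<xi>))\<^sup>2 \<partial>\<mu>)"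
    and U_mult_id: "\<And>f. f \<in> L2 ip \<mu> \<Longrightarrow> AE \<xi> in \<mu>. U (\<lambda>\<xi>. sc \<xi> (f \<xi>)) \<xi> = sc \<xi> (U f \<xi>)"
begin

text \<open>On the circle \<open>cnj \<xi>\<close> inverts \<open>\<xi>\<close>: commutation is
  applied to \<open>sc (cnj \<xi>) (f \<xi>)\<close> and the factor \<open>\<xi>\<close> is divided
  out.\<close>

lemma U_mult_cnj:
  assumes f: "f \<in> L2 ip \<mu>"
  shows "AE \<xi> in \<mu>. U (\<lambda>\<xi>. sc (cnj \<xi>) (f \<xi>)) \<xi> = sc (cnj \<xi>) (U f \<xi>)"
proof -
  let ?g = "\<lambda>\<xi>. sc (cnj \<xi>) (f \<xi>)"
  have unit: "\<xi> * cnj \<xi> = 1" if "\<xi> \<in> space \<mu>" for \<xi>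
    using that by (simp add: space_eq complex_norm_square[symmetric])
  have "AE \<xi> in \<mu>. U (\<lambda>\<xi>. sc \<xi> (?g \<xi>)) \<xi> = U f \<xi>"
    by (intro U_cong L2_mult_id L2_mult_cnj f AE_I2) (simp add: unit)
  with U_mult_id[OF L2_mult_cnj[OF f]] AE_space show ?thesis
  proof eventually_elim
    case (elim \<xi>)
    then have "sc (cnj \<xi>) (U f \<xi>) = sc (cnj \<xi>) (sc \<xi> (U ?g \<xi>))" by simp
    then show ?case using unit[OF elim(2)] by (simp add: mult.commute)
  qed
qed

lemma U_mult_polynomial:
  assumes p: "real_polynomial_function p" and f: "f \<in> L2 ip \<mu>"
  shows "AE \<xi> in \<mu>. U (\<lambda>\<xi>. sc (of_real (p \<xi>)) (f \<xi>)) \<xi> = sc (of_real (p \<xi>)) (U f \<xi>)"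
  using p f
proof (induction arbitrary: f rule: real_polynomial_function.induct)
  case (linear p)
  \<comment> \<open>A real linear functional has the form \<open>2 * Re (c * \<xi>)\<close>; its
    values at \<open>1\<close> and \<open>\<i>\<close> determine \<open>c\<close>.\<close>
  define c where "c = Complex (p 1 / 2) (- p \<i> / 2)"
  have p: "complex_of_real (p \<xi>) = c * \<xi> + cnj c * cnj \<xi>" for \<xi>
  proof -
    interpret bounded_linear p by fact
    have "p \<xi> = p (Re \<xi> *\<^sub>R 1 + Im \<xi> *\<^sub>R \<i>)"
      by (rule arg_cong[of _ _ p]) (simp add: complex_eq_iff)
    also have "\<dots> = Re \<xi> * p 1 + Im \<xi> * p \<i>" by (simp only: add scaleR real_scaleR_def)
    finally show ?thesis by (simp add: c_def complex_eq_iff algebra_simps)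
  qed
  let ?f1 = "\<lambda>\<xi>. sc \<xi> (f \<xi>)" and ?f2 = "\<lambda>\<xi>. sc (cnj \<xi>) (f \<xi>)"
  have L: "?f1 \<in> L2 ip \<mu>" "?f2 \<in> L2 ip \<mu>"
    using linear by (auto intro: L2_mult_id L2_mult_cnj)
  have eq: "(\<lambda>\<xi>. sc (of_real (p \<xi>)) (f \<xi>)) = (\<lambda>\<xi>. sc c (?f1 \<xi>) + sc (cnj c) (?f2 \<xi>))"
    by (simp add: p scale_left_distrib)
  show ?case
    unfolding eq
    using U_add[OF L2_scale[OF L(1), of c] L2_scale[OF L(2), of "cnj c"]]
      U_scale[OF L(1), of c] U_scale[OF L(2), of "cnj c"]
      U_mult_id[OF linear(2)] U_mult_cnj[OF linear(2)]
    by eventually_elim (simp add: p scale_left_distrib)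
next
  case (const c)
  then show ?case by (rule U_scale)
next
  case (add p q)
  have eq: "(\<lambda>\<xi>. sc (of_real (p \<xi> + q \<xi>)) (f \<xi>))
      = (\<lambda>\<xi>. sc (of_real (p \<xi>)) (f \<xi>) + sc (of_real (q \<xi>)) (f \<xi>))"
    by (simp add: scale_left_distrib)
  show ?case
    unfolding eq
    using U_add[OF L2_mult_polynomial[OF add.prems add.hyps(1)] L2_mult_polynomial[OF add.prems add.hyps(2)]]
      add.IH(1)[OF add.prems] add.IH(2)[OF add.prems]
    by eventually_elim (simp add: scale_left_distrib)
next
  case (mult p q)
  have eq: "(\<lambda>\<xi>. sc (of_real (p \<xi> * q \<xi>)) (f \<xi>))
      = (\<lambda>\<xi>. sc (of_real (p \<xi>)) (sc (of_real (q \<xi>)) (f \<xi>)))"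
    by simp
  show ?case
    unfolding eq
    using mult.IH(1)[OF L2_mult_polynomial[OF mult.prems mult.hyps(2)]] mult.IH(2)[OF mult.prems]
    by eventually_elim simp
qed

text \<open>Testing against \<open>p = ((p+1)/2)\<^sup>2 - ((p-1)/2)\<^sup>2\<close> makes the global isometry property
  hold pointwise.\<close>

lemma U_nrm:
  assumes f: "f \<in> L2 ip \<mu>"
  shows "AE \<xi> in \<mu>. (nrm (U f \<xi>))\<^sup>2 = (nrm (f \<xi>))\<^sup>2"
proof -
  let ?\<phi> = "\<lambda>\<xi>. (nrm (U f \<xi>))\<^sup>2 - (nrm (f \<xi>))\<^sup>2"
  \<comment> \<open>The isometry is applied to \<open>f\<close> multiplied by \<open>q\<close>.
    Norms see the multiplier only through its square, so squares come first.\<close>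
  have sq: "integrable \<mu> (\<lambda>\<xi>. (q \<xi>)\<^sup>2 * ?\<phi> \<xi>) \<and> (\<integral>\<xi>. (q \<xi>)\<^sup>2 * ?\<phi> \<xi> \<partial>\<mu>) = 0"
    if q: "real_polynomial_function q" for q
  proof -
    let ?qf = "\<lambda>\<xi>. sc (of_real (q \<xi>)) (f \<xi>)" and ?qU = "\<lambda>\<xi>. sc (of_real (q \<xi>)) (U f \<xi>)"
    have L: "?qf \<in> L2 ip \<mu>" "?qU \<in> L2 ip \<mu>"
      by (intro L2_mult_polynomial f U_L2 q)+
    have eq: "(q \<xi>)\<^sup>2 * ?\<phi> \<xi> = (nrm (?qU \<xi>))\<^sup>2 - (nrm (?qf \<xi>))\<^sup>2" for \<xi>
      by (simp add: nrm_scale power_mult_distrib algebra_simps)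
    have "(\<integral>\<xi>. (nrm (?qU \<xi>))\<^sup>2 \<partial>\<mu>) = (\<integral>\<xi>. (nrm (U ?qf \<xi>))\<^sup>2 \<partial>\<mu>)"
      using U_mult_polynomial[OF q f] borel_measurable_nrm[OF L2_hmeasurable[OF L(2)]]
        borel_measurable_nrm[OF L2_hmeasurable[OF U_L2[OF L(1)]]]
      by (intro integral_cong_AE) (auto elim!: eventually_mono)
    then show ?thesis
      unfolding eq using L2_integrable[OF L(1)] L2_integrable[OF L(2)] U_norm[OF L(1)] by simp
  qed
  have "AE \<xi> in \<mu>. ?\<phi> \<xi> = 0"
  proof (rule AE_zero_if_orthogonal_to_polynomials)
    show "integrable \<mu> ?\<phi>"
      using L2_integrable[OF f] L2_integrable[OF U_L2[OF f]] by simp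
    fix p :: "complex \<Rightarrow> real" assume p: "real_polynomial_function p"
    let ?q1 = "\<lambda>\<xi>. (1/2) * p \<xi> + 1/2" and ?q2 = "\<lambda>\<xi>. (1/2) * p \<xi> + - 1/2"
    have q: "real_polynomial_function ?q1" "real_polynomial_function ?q2"
      by (rule real_polynomial_function.intros(3)[OF real_polynomial_function.intros(4)
            [OF real_polynomial_function.intros(2) p] real_polynomial_function.intros(2)])+
    have "p \<xi> * ?\<phi> \<xi> = (?q1 \<xi>)\<^sup>2 * ?\<phi> \<xi> - (?q2 \<xi>)\<^sup>2 * ?\<phi> \<xi>" for \<xi>
      by (simp add: power2_eq_square field_simps)
    then show "(\<integral>\<xi>. p \<xi> * ?\<phi> \<xi> \<partial>\<mu>) = 0"
      using sq[OF q(1)] sq[OF q(2)] by simp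
  qed
  then show ?thesis by simp
qed

text \<open>The norm identity is polarized fibre by fibre; passing from \<open>g\<close> to its
  multiple by \<open>\<i>\<close> yields the imaginary part.\<close>

lemma U_ip:
  assumes f: "f \<in> L2 ip \<mu>" and g: "g \<in> L2 ip \<mu>"
  shows "AE \<xi> in \<mu>. ip (U f \<xi>) (U g \<xi>) = ip (f \<xi>) (g \<xi>)"
proof -
  have Re: "AE \<xi> in \<mu>. Re (ip (U f \<xi>) (U g \<xi>)) = Re (ip (f \<xi>) (g \<xi>))"
    if g: "g \<in> L2 ip \<mu>" for g
    using U_nrm[OF f] U_nrm[OF g] U_nrm[OF L2_add[OF f g]] U_add[OF f g]
    by eventually_elim (simp add: Re_ip_polar)
  show ?thesis
    using Re[OF g] Re[OF L2_scale[OF g, of \<i>]] U_scale[OF g, of \<i>]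
    by eventually_elim (simp add: complex_eq_iff Im_ip_eq)
qed

text \<open>Off a single null set the \<open>g k \<xi>\<close> have the same inner products as the
  \<open>d k\<close>, so \<open>isometry_extension\<close> gives the fibre operators. Pairing
  \<open>U f\<close> with the countably many \<open>g k\<close> identifies it as the fibrewise image
  of \<open>f\<close>.\<close>

lemma U_decomposable:
  obtains F where "\<And>\<xi> x y. ip (F \<xi> x) (F \<xi> y) = ip x y"
    and "\<And>x y. (\<lambda>\<xi>. ip (F \<xi> x) y) \<in> borel_measurable \<mu>"
    and "\<And>f. f \<in> L2 ip \<mu> \<Longrightarrow> AE \<xi> in \<mu>. U f \<xi> = F \<xi> (f \<xi>)"
proof -
  obtain d :: "nat \<Rightarrow> 'h" where d: "\<And>x e. e > 0 \<Longrightarrow> \<exists>k. nrm (x - d k) < e"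
    using dense_sequence by blast
  define g where "g k = U (\<lambda>_. d k)" for k
  have g: "g k \<in> L2 ip \<mu>" for k unfolding g_def by (intro U_L2 L2_const)
  have "AE \<xi> in \<mu>. \<forall>k l. ip (g k \<xi>) (g l \<xi>) = ip (d k) (d l)"
    unfolding AE_all_countable g_def by (intro allI U_ip L2_const)
  then obtain N where N: "N \<in> null_sets \<mu>"
    and good: "\<And>\<xi> k l. \<xi> \<in> space \<mu> - N \<Longrightarrow> ip (g k \<xi>) (g l \<xi>) = ip (d k) (d l)"
    by (auto elim!: AE_E3)
  \<comment> \<open>Off the good set the value defaults to the identity, which makes every fibre
    isometric and keeps the sections measurable.\<close>
  define G where "G \<xi> k = (if \<xi> \<in> space \<mu> - N then g k \<xi> else d k)" for \<xi> k
  have G: "ip (G \<xi> k) (G \<xi> l) = ip (d k) (d l)" for \<xi> k l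
    using good by (simp add: G_def)
  have "\<exists>V. (\<forall>x y. ip (V x) (V y) = ip x y) \<and> (\<forall>k. V (d k) = G \<xi> k)" for \<xi>
    using isometry_extension[OF d G] by metis
  then obtain F where F: "\<And>\<xi> x y. ip (F \<xi> x) (F \<xi> y) = ip x y"
    and Fd: "\<And>\<xi> k. F \<xi> (d k) = G \<xi> k"
    by metis
  have F_diff: "nrm (F \<xi> x - F \<xi> y) = nrm (x - y)" for \<xi> x y
    by (simp add: hnorm_def ip_simps F)
  show ?thesis
  proof (rule that[of F])
    show "ip (F \<xi> x) (F \<xi> y) = ip x y" for \<xi> x y by (rule F)
    show "(\<lambda>\<xi>. ip (F \<xi> x) y) \<in> borel_measurable \<mu>" for x y
    proof -
      obtain k where k: "(\<lambda>n. nrm (d (k n) - x)) \<longlonglongrightarrow> 0"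
        using approx_sequence[of d, OF d] by blast
      have lim: "(\<lambda>n. ip (F \<xi> (d (k n))) y) \<longlonglongrightarrow> ip (F \<xi> x) y" for \<xi>
        by (rule tendsto_ip_left) (simp add: F_diff k)
      have meas: "(\<lambda>\<xi>. ip (F \<xi> (d (k n))) y) \<in> borel_measurable \<mu>" for n
      proof -
        have "(\<lambda>\<xi>. if \<xi> \<in> space \<mu> - N then ip (g (k n) \<xi>) y else ip (d (k n)) y) \<in> borel_measurable \<mu>"
        proof (rule measurable_If_set)
          show "(\<lambda>\<xi>. ip (g (k n) \<xi>) y) \<in> borel_measurable \<mu>"
            by (rule borel_measurable_ip[OF L2_hmeasurable[OF g]])
          show "(space \<mu> - N) \<inter> space \<mu> \<in> sets \<mu>"
            by (intro sets.Int sets.Diff null_setsD2[OF N] sets.top)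
        qed simp
        then show ?thesis by (simp add: Fd G_def if_distrib[of "\<lambda>x. ip x y"])
      qed
      show ?thesis by (rule borel_measurable_LIMSEQ_metric[OF meas lim])
    qed
    show "AE \<xi> in \<mu>. U f \<xi> = F \<xi> (f \<xi>)" if f: "f \<in> L2 ip \<mu>" for f
    proof -
      have "AE \<xi> in \<mu>. \<forall>k. ip (U f \<xi>) (g k \<xi>) = ip (f \<xi>) (d k)"
        unfolding AE_all_countable g_def by (intro allI U_ip L2_const f)
      then show ?thesis
        using U_nrm[OF f] AE_not_in[OF N] AE_space
      proof eventually_elim
        case (elim \<xi>)
        obtain k where k: "(\<lambda>n. nrm (d (k n) - f \<xi>)) \<longlonglongrightarrow> 0"
          using approx_sequence[of d, OF d] by blast
        have "(\<lambda>n. ip (g (k n) \<xi>) (U f \<xi>)) \<longlonglongrightarrow> ip (F \<xi> (f \<xi>)) (U f \<xi>)"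
          using tendsto_ip_left[of "\<lambda>n. F \<xi> (d (k n))" "F \<xi> (f \<xi>)" "U f \<xi>"] k elim
          by (simp add: F_diff) (simp add: Fd G_def)
        moreover have "ip (g (k n) \<xi>) (U f \<xi>) = ip (d (k n)) (f \<xi>)" for n
          using elim(1) ip_commute by metis
        ultimately have "ip (F \<xi> (f \<xi>)) (U f \<xi>) = ip (f \<xi>) (f \<xi>)"
          using tendsto_ip_left[OF k, of "f \<xi>"] LIMSEQ_unique by auto
        \<comment> \<open>Equal norms together with this inner product identify the two
          vectors.\<close>
        then have "ip (F \<xi> (f \<xi>)) (U f \<xi>) = ip (U f \<xi>) (U f \<xi>)"
          using elim(2) by (simp add: ip_self)
        then have "F \<xi> (f \<xi>) = U f \<xi>"
          using elim(2) by (intro eq_if_ip_eq) (simp_all add: nrm_sq F)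
        then show ?case by simp
      qed
    qed
  qed
qed

end

end

section \<open>Conjugations and invariant subspaces\<close>

lemma borel_measurable_cnj: "f \<in> borel_measurable M \<Longrightarrow> (\<lambda>x. cnj (f x)) \<in> borel_measurable M"
  by (rule measurable_compose[OF _ borel_measurable_continuous_onI]) (auto intro: continuous_intros)

locale conjugation_L2 = hilbert_conjugation sc ip J + vector_L2 sc ip \<mu>
  for sc :: "complex \<Rightarrow> 'h::ab_group_add \<Rightarrow> 'h" and ip :: "'h \<Rightarrow> 'h \<Rightarrow> complex"
    and J :: "'h \<Rightarrow> 'h" and \<mu>
begin

section \<open>The conjugation \<open>J#\<close> and its twists by symmetric unitaries\<close>

abbreviation "Js \<equiv> Jsharp sc \<mu> J"

abbreviation root_h :: "complex \<Rightarrow> complex" where "root_h \<xi> \<equiv> of_real (sqrt (h \<xi>))"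

lemma Js_eq: "Js f \<xi> = sc (root_h \<xi>) (J (f (cnj \<xi>)))"
  by (simp add: Jsharp_def h_def)

lemma root_h_cnj: "AE \<xi> in \<mu>. root_h \<xi> * root_h (cnj \<xi>) = 1"
  using h_cnj by eventually_elim (simp flip: of_real_mult real_sqrt_mult)

lemma hmeasurable_Js:
  assumes f: "hmeasurable ip \<mu> f"
  shows "hmeasurable ip \<mu> (Js f)"
proof -
  have "hmeasurable ip \<mu> (\<lambda>\<xi>. J (f (cnj \<xi>)))"
  proof (rule hmeasurableI)
    fix e
    show "(\<lambda>\<xi>. ip (J (f (cnj \<xi>))) e) \<in> borel_measurable \<mu>"
      unfolding ip_J_left
      by (intro borel_measurable_cnj measurable_comp_cnj borel_measurable_ip[OF f])
  qed
  then have "hmeasurable ip \<mu> (\<lambda>\<xi>. sc (root_h \<xi>) (J (f (cnj \<xi>))))"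
    by (intro hmeasurable_scale) measurable
  then show ?thesis by (simp add: Js_eq[abs_def])
qed

lemma nrm_Js_sq: "(nrm (Js f \<xi>))\<^sup>2 = h \<xi> * (nrm (f (cnj \<xi>)))\<^sup>2"
  by (simp add: Js_eq nrm_scale power_mult_distrib)

lemma L2_Js:
  assumes f: "f \<in> L2 ip \<mu>" shows "Js f \<in> L2 ip \<mu>"
proof (rule L2_I)
  show "integrable \<mu> (\<lambda>\<xi>. (nrm (Js f \<xi>))\<^sup>2)"
    unfolding nrm_Js_sq by (rule integrable_h_cnj(1)[OF L2_integrable[OF f]])
qed (rule hmeasurable_Js[OF L2_hmeasurable[OF f]])

lemma integral_nrm_Js:
  "f \<in> L2 ip \<mu> \<Longrightarrow> (\<integral>\<xi>. (nrm (Js f \<xi>))\<^sup>2 \<partial>\<mu>) = (\<integral>\<xi>. (nrm (f \<xi>))\<^sup>2 \<partial>\<mu>)"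
  unfolding nrm_Js_sq by (rule integrable_h_cnj(2)[OF L2_integrable])

lemma Js_cong:
  assumes "AE \<xi> in \<mu>. f \<xi> = g \<xi>" shows "AE \<xi> in \<mu>. Js f \<xi> = Js g \<xi>"
  using AE_cnj[OF assms] by eventually_elim (simp add: Js_eq)

lemma Js_Js: "AE \<xi> in \<mu>. Js (Js f) \<xi> = f \<xi>"
  using root_h_cnj by eventually_elim (simp add: Js_eq J_scale)

text \<open>Every conjugation commuting with \<open>M\<^sub>\<xi>\<close> turns out to have the form considered here.\<close>

lemma twisted_conjugation:
  assumes V_add: "\<And>\<xi> x y. V \<xi> (x + y) = V \<xi> x + V \<xi> y"
    and V_scale: "\<And>\<xi> a x. V \<xi> (sc a x) = sc a (V \<xi> x)"
    and V_nrm: "\<And>\<xi> x. nrm (V \<xi> x) = nrm x"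
    and V_meas: "\<And>f. hmeasurable ip \<mu> f \<Longrightarrow> hmeasurable ip \<mu> (\<lambda>\<xi>. V \<xi> (f \<xi>))"
    and V_J: "\<And>\<xi> x. J (V (cnj \<xi>) (J (V \<xi> x))) = x"
  shows "L2_conj sc ip \<mu> (\<lambda>f. Js (\<lambda>\<xi>. V \<xi> (f \<xi>)))"
    and "commutes_Mxi sc ip \<mu> (\<lambda>f. Js (\<lambda>\<xi>. V \<xi> (f \<xi>)))"
proof -
  have V_L2: "(\<lambda>\<xi>. V \<xi> (f \<xi>)) \<in> L2 ip \<mu>" if "f \<in> L2 ip \<mu>" for f
    by (rule L2_bounded[OF that V_meas[OF L2_hmeasurable[OF that]], of 1]) (simp add: V_nrm)
  \<comment> \<open>One computation with a multiplier \<open>a\<close> serves two ends: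
    \<open>a \<xi> = \<xi>\<close> gives the commutation, \<open>a \<xi> = 1\<close> the
    involution.\<close>
  have twice: "AE \<xi> in \<mu>. Js (\<lambda>\<xi>. V \<xi> (sc (a \<xi>) (Js (\<lambda>\<xi>. V \<xi> (f \<xi>)) \<xi>))) \<xi> = sc (cnj (a (cnj \<xi>))) (f \<xi>)"
    for a f using root_h_cnj
  proof eventually_elim
    case (elim \<xi>)
    show ?case
      using elim by (simp add: Js_eq V_scale J_scale V_J mult_ac)
  qed
  show "commutes_Mxi sc ip \<mu> (\<lambda>f. Js (\<lambda>\<xi>. V \<xi> (f \<xi>)))"
    unfolding commutes_Mxi_def aeq_def using twice[of "\<lambda>\<xi>. \<xi>"] by simp
  show "L2_conj sc ip \<mu> (\<lambda>f. Js (\<lambda>\<xi>. V \<xi> (f \<xi>)))"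
    unfolding L2_conj_def aeq_def
  proof (intro conjI ballI allI impI)
    fix f g assume f: "f \<in> L2 ip \<mu>"
    show "Js (\<lambda>\<xi>. V \<xi> (f \<xi>)) \<in> L2 ip \<mu>" by (intro L2_Js V_L2 f)
    show "AE \<xi> in \<mu>. Js (\<lambda>\<xi>. V \<xi> (f \<xi> + g \<xi>)) \<xi> = Js (\<lambda>\<xi>. V \<xi> (f \<xi>)) \<xi> + Js (\<lambda>\<xi>. V \<xi> (g \<xi>)) \<xi>"
      by (simp add: Js_eq V_add J_add scale_right_distrib)
    show "AE \<xi> in \<mu>. Js (\<lambda>\<xi>. V \<xi> (sc a (f \<xi>))) \<xi> = sc (cnj a) (Js (\<lambda>\<xi>. V \<xi> (f \<xi>)) \<xi>)" for a
      by (simp add: Js_eq V_scale J_scale mult.commute)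
    show "l2norm ip \<mu> (Js (\<lambda>\<xi>. V \<xi> (f \<xi>))) = l2norm ip \<mu> f"
      unfolding l2norm_def integral_nrm_Js[OF V_L2[OF f]] by (simp add: V_nrm)
    show "AE \<xi> in \<mu>. Js (\<lambda>\<xi>. V \<xi> (Js (\<lambda>\<xi>. V \<xi> (f \<xi>)) \<xi>)) \<xi> = f \<xi>"
      using twice[of "\<lambda>_. 1"] by simp
    show "AE \<xi> in \<mu>. Js (\<lambda>\<xi>. V \<xi> (f \<xi>)) \<xi> = Js (\<lambda>\<xi>. V \<xi> (g \<xi>)) \<xi>" if "AE \<xi> in \<mu>. f \<xi> = g \<xi>"
      using that by (intro Js_cong) (auto elim: eventually_mono)
  qed
qed

lemma Js_conjugation: "L2_conj sc ip \<mu> Js" "commutes_Mxi sc ip \<mu> Js"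
  using twisted_conjugation[of "\<lambda>_ x. x"] by simp_all

end

locale invariant_subspace = conjugation_L2 sc ip J \<mu>
  for sc :: "complex \<Rightarrow> 'h::ab_group_add \<Rightarrow> 'h" and ip :: "'h \<Rightarrow> 'h \<Rightarrow> complex"
    and J :: "'h \<Rightarrow> 'h" and \<mu> +
  fixes K :: "(complex \<Rightarrow> 'h) set"
  assumes K: "L2_closed_subspace sc ip \<mu> K"
begin

lemma
  shows K_L2: "f \<in> K \<Longrightarrow> f \<in> L2 ip \<mu>"
    and K_cong: "f \<in> K \<Longrightarrow> g \<in> L2 ip \<mu> \<Longrightarrow> (AE \<xi> in \<mu>. f \<xi> = g \<xi>) \<Longrightarrow> g \<in> K"
    and K_add: "f \<in> K \<Longrightarrow> g \<in> K \<Longrightarrow> (\<lambda>\<xi>. f \<xi> + g \<xi>) \<in> K"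
    and K_scale: "f \<in> K \<Longrightarrow> (\<lambda>\<xi>. sc a (f \<xi>)) \<in> K"
    and K_closed: "(\<And>n. s n \<in> K) \<Longrightarrow> f \<in> L2 ip \<mu> \<Longrightarrow>
      (\<lambda>n. l2norm ip \<mu> (\<lambda>\<xi>. s n \<xi> - f \<xi>)) \<longlonglongrightarrow> 0 \<Longrightarrow> f \<in> K"
proof -
  note * = K[unfolded L2_closed_subspace_def aeq_def]
  show "f \<in> K \<Longrightarrow> f \<in> L2 ip \<mu>"
    using *[THEN conjunct1] by (rule subsetD)
  show "f \<in> K \<Longrightarrow> g \<in> L2 ip \<mu> \<Longrightarrow> (AE \<xi> in \<mu>. f \<xi> = g \<xi>) \<Longrightarrow> g \<in> K"
    by (rule *[THEN conjunct2, THEN conjunct1, rule_format])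
  show "f \<in> K \<Longrightarrow> g \<in> K \<Longrightarrow> (\<lambda>\<xi>. f \<xi> + g \<xi>) \<in> K"
    by (rule *[THEN conjunct2, THEN conjunct2, THEN conjunct2, THEN conjunct1, rule_format])
  show "f \<in> K \<Longrightarrow> (\<lambda>\<xi>. sc a (f \<xi>)) \<in> K"
    by (rule *[THEN conjunct2, THEN conjunct2, THEN conjunct2, THEN conjunct2, THEN conjunct1, rule_format])
  show "(\<And>n. s n \<in> K) \<Longrightarrow> f \<in> L2 ip \<mu> \<Longrightarrow>
      (\<lambda>n. l2norm ip \<mu> (\<lambda>\<xi>. s n \<xi> - f \<xi>)) \<longlonglongrightarrow> 0 \<Longrightarrow> f \<in> K"
    by (rule *[THEN conjunct2, THEN conjunct2, THEN conjunct2, THEN conjunct2, THEN conjunct2, rule_format])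
qed

section \<open>From invariance under conjugations to invariance under multiplications\<close>

context
  assumes inv: "\<forall>C. L2_conj sc ip \<mu> C \<and> commutes_Mxi sc ip \<mu> C \<longrightarrow> (\<forall>f\<in>K. C f \<in> K)"
begin

lemma K_inv: "L2_conj sc ip \<mu> C \<Longrightarrow> commutes_Mxi sc ip \<mu> C \<Longrightarrow> f \<in> K \<Longrightarrow> C f \<in> K"
  using inv by blast

lemma K_Js: "f \<in> K \<Longrightarrow> Js f \<in> K"
  by (rule K_inv[OF Js_conjugation])

text \<open>\<open>J#\<close> after multiplication by \<open>V\<close> is an admissible conjugation,
  and a further \<open>J#\<close>, admissible as well, cancels the first. The last condition on
  \<open>V\<close> says that \<open>V (cnj \<xi>)\<close>, conjugated by \<open>J\<close>, inverts
  \<open>V \<xi>\<close>.\<close>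

lemma K_unitary:
  assumes V_add: "\<And>\<xi> x y. V \<xi> (x + y) = V \<xi> x + V \<xi> y"
    and V_scale: "\<And>\<xi> a x. V \<xi> (sc a x) = sc a (V \<xi> x)"
    and V_nrm: "\<And>\<xi> x. nrm (V \<xi> x) = nrm x"
    and V_meas: "\<And>f. hmeasurable ip \<mu> f \<Longrightarrow> hmeasurable ip \<mu> (\<lambda>\<xi>. V \<xi> (f \<xi>))"
    and V_J: "\<And>\<xi> x. J (V (cnj \<xi>) (J (V \<xi> x))) = x"
    and f: "f \<in> K"
  shows "(\<lambda>\<xi>. V \<xi> (f \<xi>)) \<in> K"
proof (rule K_cong)
  show "Js (Js (\<lambda>\<xi>. V \<xi> (f \<xi>))) \<in> K"
    by (rule K_Js, rule K_inv[OF twisted_conjugation[of V]]) (fact assms)+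
  show "(\<lambda>\<xi>. V \<xi> (f \<xi>)) \<in> L2 ip \<mu>"
    by (rule L2_bounded[OF K_L2[OF f] V_meas[OF L2_hmeasurable[OF K_L2[OF f]]], of 1]) (simp add: V_nrm)
qed (rule Js_Js)

text \<open>With \<open>R = (1 - \<i>tT)\<^sup>-\<^sup>1\<close>, the Cayley transform \<open>2R - 1\<close> is a symmetric unitary, so \<open>K\<close> is
  invariant under \<open>TR = (R - 1)/(\<i>t)\<close>, which tends to \<open>T\<close> in norm as \<open>t \<rightarrow> 0\<close>.\<close>

lemma K_selfadjoint:
  assumes T_add: "\<And>\<xi> x y. T \<xi> (x + y) = T \<xi> x + T \<xi> y"
    and T_scale: "\<And>\<xi> a x. T \<xi> (sc a x) = sc a (T \<xi> x)"
    and T_bound: "\<And>\<xi> x. nrm (T \<xi> x) \<le> M * nrm x" and M: "M \<ge> 0"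
    and T_self: "\<And>\<xi> x y. ip (T \<xi> x) y = ip x (T \<xi> y)"
    and T_meas: "\<And>x y. (\<lambda>\<xi>. ip (T \<xi> x) y) \<in> borel_measurable \<mu>"
    and T_J: "\<And>\<xi> x. J (T \<xi> (J x)) = T (cnj \<xi>) x"
    and f: "f \<in> K"
  shows "(\<lambda>\<xi>. T \<xi> (f \<xi>)) \<in> K"
proof -
  have T_apply: "hmeasurable ip \<mu> (\<lambda>\<xi>. T \<xi> (g \<xi>))" if "hmeasurable ip \<mu> g" for g
    by (rule hmeasurable_apply[OF that _ T_meas])
       (unfold hbounded_linear_def, intro conjI exI allI, (rule T_add T_scale T_bound)+)
  have f_L2: "f \<in> L2 ip \<mu>" by (rule K_L2[OF f])
  have Tf: "(\<lambda>\<xi>. T \<xi> (f \<xi>)) \<in> L2 ip \<mu>"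
    by (rule L2_bounded[OF f_L2 T_apply[OF L2_hmeasurable[OF f_L2]], of M]) (simp add: T_bound)
  have step: "\<exists>g\<in>K. \<forall>\<xi>. nrm (g \<xi> - T \<xi> (f \<xi>)) \<le> (M * t * M) * nrm (f \<xi>)"
    if t: "t > 0" "t * M \<le> 1/2" for t :: real
  proof -
    define S where "S \<xi> x = sc (of_real t) (T \<xi> x)" for \<xi> x
    have S: "selfadjoint_half (S \<xi>)" for \<xi>
      unfolding selfadjoint_half_def
    proof (intro conjI allI)
      show "nrm (S \<xi> x) \<le> nrm x / 2" for x
      proof -
        have "nrm (S \<xi> x) = t * nrm (T \<xi> x)" using t(1) by (simp add: S_def nrm_scale)
        also have "\<dots> \<le> t * (M * nrm x)" using t(1) by (intro mult_left_mono T_bound) simp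
        also have "\<dots> \<le> 1/2 * nrm x"
          using mult_right_mono[OF t(2), of "nrm x"] by (simp add: mult.assoc)
        finally show ?thesis by simp
      qed
    qed (simp_all add: S_def T_add T_scale scale_right_distrib mult.commute ip_simps T_self)
    have conj: "J (S \<xi> (J x)) = S (cnj \<xi>) x" for \<xi> x
      by (simp add: S_def J_scale T_J)
    have res: "hmeasurable ip \<mu> (\<lambda>\<xi>. resolvent (S \<xi>) (g \<xi>))" if g: "hmeasurable ip \<mu> g" for g
    proof (rule hmeasurableI)
      fix e
      \<comment> \<open>Each iterate is built by measurable operations, and measurability survives
        the limit.\<close>
      have "hmeasurable ip \<mu> (\<lambda>\<xi>. neumann (S \<xi>) (g \<xi>) n)" for n
      proof (induction n)
        case (Suc n)
        show ?case
          unfolding neumann_simps S_def[of _ "neumann _ _ _"]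
          by (intro hmeasurable_add g hmeasurable_scale T_apply Suc borel_measurable_const)
      qed (simp add: hmeasurable_const)
      then show "(\<lambda>\<xi>. ip (resolvent (S \<xi>) (g \<xi>)) e) \<in> borel_measurable \<mu>"
        by (rule borel_measurable_LIMSEQ_metric[OF borel_measurable_ip])
           (rule tendsto_ip_left[OF neumann_tendsto_resolvent[OF S]])
    qed
    have cayley_K: "(\<lambda>\<xi>. cayley (S \<xi>) (f \<xi>)) \<in> K"
    proof (rule K_unitary[of "\<lambda>\<xi>. cayley (S \<xi>)"])
      show "hmeasurable ip \<mu> (\<lambda>\<xi>. cayley (S \<xi>) (g \<xi>))" if "hmeasurable ip \<mu> g" for g
        unfolding cayley_def
        by (intro hmeasurable_diff hmeasurable_scale res that borel_measurable_const)
      show "J (cayley (S (cnj \<xi>)) (J (cayley (S \<xi>) x))) = x" for \<xi> x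
        by (rule J_cayley_J_cayley[OF S S conj])
    qed (simp_all add: cayley_add[OF S] cayley_scale[OF S] nrm_cayley[OF S] f)
    \<comment> \<open>With \<open>R\<close> the resolvent, the Cayley transform minus 1 is
      \<open>2(R - 1) = 2\<i>tTR\<close>, so this factor leaves \<open>TR\<close> applied to
      \<open>f\<close>.\<close>
    define c where "c = 1 / (2 * \<i> * complex_of_real t)"
    define g where "g \<xi> = sc c (cayley (S \<xi>) (f \<xi>) + sc (-1) (f \<xi>))" for \<xi>
    have "g \<in> K" unfolding g_def[abs_def] by (intro K_scale K_add cayley_K f)
    moreover have "nrm (g \<xi> - T \<xi> (f \<xi>)) \<le> (M * t * M) * nrm (f \<xi>)" for \<xi>
    proof -
      let ?y = "resolvent (S \<xi>) (f \<xi>)"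
      have diff: "?y - f \<xi> = sc (\<i> * of_real t) (T \<xi> ?y)"
        using resolvent_eq[OF S, of \<xi> "f \<xi>"] by (simp add: S_def algebra_simps)
      have "cayley (S \<xi>) (f \<xi>) + sc (-1) (f \<xi>) = sc 2 (?y - f \<xi>)"
        using scale_left_distrib[of 1 1 "f \<xi>"]
        by (simp add: cayley_def scale_right_diff_distrib)
      then have "g \<xi> = T \<xi> ?y"
        using t(1) by (simp add: g_def diff c_def)
      \<comment> \<open>The error is \<open>T(R - 1) = T(\<i>tTR)\<close>, and \<open>R\<close> does
        not increase norms; hence the bound of order \<open>t\<close>.\<close>
      then have "g \<xi> - T \<xi> (f \<xi>) = T \<xi> (?y - f \<xi>)"
        by (metis T_add add_diff_cancel diff_add_cancel)
      then have "nrm (g \<xi> - T \<xi> (f \<xi>)) \<le> M * nrm (sc (\<i> * of_real t) (T \<xi> ?y))"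
        using T_bound[of \<xi> "?y - f \<xi>"] by (simp only: diff)
      also have "\<dots> = M * t * nrm (T \<xi> ?y)"
        using t(1) by (simp add: nrm_scale norm_mult)
      also have "\<dots> \<le> M * t * (M * nrm (f \<xi>))"
        using t(1) M nrm_resolvent[OF S, of \<xi> "f \<xi>"] T_bound[of \<xi> ?y]
        by (intro mult_left_mono order_trans[OF T_bound]) auto
      finally show ?thesis by (simp add: mult.assoc)
    qed
    ultimately show ?thesis by blast
  qed
  \<comment> \<open>The first factor keeps \<open>t n * M\<close> at most \<open>1/2\<close>, with
    the summand 1 guarding against \<open>M = 0\<close>; the second tends to 0.\<close>
  define t where "t n = 1 / (2 * (M + 1)) * inverse (real (Suc n))" for n
  have t: "t n > 0" "t n * M \<le> 1/2" for n
  proof -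
    show "t n > 0" using M by (simp add: t_def)
    have "t n * M = (M / (2 * (M + 1))) * inverse (real (Suc n))" by (simp add: t_def)
    also have "\<dots> \<le> (1/2) * 1"
      using M by (intro mult_mono) (auto simp: field_simps)
    finally show "t n * M \<le> 1/2" by simp
  qed
  obtain g where gK: "\<And>n. g n \<in> K"
    and g: "\<And>n \<xi>. nrm (g n \<xi> - T \<xi> (f \<xi>)) \<le> (M * t n * M) * nrm (f \<xi>)"
    using step[OF t] by metis
  have bound: "l2norm ip \<mu> (\<lambda>\<xi>. g n \<xi> - T \<xi> (f \<xi>)) \<le> (M * t n * M) * l2norm ip \<mu> f" for n
  proof (rule power2_le_imp_le)
    have "(\<integral>\<xi>. (nrm (g n \<xi> - T \<xi> (f \<xi>)))\<^sup>2 \<partial>\<mu>) \<le> (\<integral>\<xi>. (M * t n * M)\<^sup>2 * (nrm (f \<xi>))\<^sup>2 \<partial>\<mu>)"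
    proof (rule integral_mono)
      show "(nrm (g n \<xi> - T \<xi> (f \<xi>)))\<^sup>2 \<le> (M * t n * M)\<^sup>2 * (nrm (f \<xi>))\<^sup>2" for \<xi>
        using power_mono[OF g nrm_ge_0, of n \<xi> 2] by (simp only: power_mult_distrib)
    qed (use L2_integrable[OF L2_diff[OF K_L2[OF gK] Tf]] L2_integrable[OF f_L2] in auto)
    then show "(l2norm ip \<mu> (\<lambda>\<xi>. g n \<xi> - T \<xi> (f \<xi>)))\<^sup>2 \<le> ((M * t n * M) * l2norm ip \<mu> f)\<^sup>2"
      unfolding power_mult_distrib[of _ "l2norm ip \<mu> f"] l2norm_sq by simp
    show "0 \<le> (M * t n * M) * l2norm ip \<mu> f"
      using M t(1)[of n] by (intro mult_nonneg_nonneg) (auto simp: l2norm_def)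
  qed
  have "(\<lambda>n. (M * t n * M) * l2norm ip \<mu> f) \<longlonglongrightarrow> (M * (1 / (2 * (M + 1)) * 0) * M) * l2norm ip \<mu> f"
    unfolding t_def by (intro tendsto_intros LIMSEQ_inverse_real_of_nat)
  then have lim: "(\<lambda>n. (M * t n * M) * l2norm ip \<mu> f) \<longlonglongrightarrow> 0" by simp
  have "norm (l2norm ip \<mu> (\<lambda>\<xi>. g n \<xi> - T \<xi> (f \<xi>))) \<le> (M * t n * M) * l2norm ip \<mu> f" for n
    using bound[of n] by (simp add: l2norm_def)
  then have "(\<lambda>n. l2norm ip \<mu> (\<lambda>\<xi>. g n \<xi> - T \<xi> (f \<xi>))) \<longlonglongrightarrow> 0"
    by (rule Lim_null_comparison[OF always_eventually[OF allI] lim])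
  then show ?thesis by (rule K_closed[OF gK Tf])
qed

end

text \<open>After a correction on a null set, boundedness and symmetry hold everywhere. The
  conjugated reflection \<open>F1\<close> is then the adjoint of \<open>F0\<close>, and the real and
  imaginary parts of \<open>F0\<close> fall under \<open>K_selfadjoint\<close>.\<close>

lemma K_Linf_c:
  assumes inv: "\<forall>C. L2_conj sc ip \<mu> C \<and> commutes_Mxi sc ip \<mu> C \<longrightarrow> (\<forall>f\<in>K. C f \<in> K)"
    and F: "F \<in> Linf_c sc ip \<mu> J" and f: "f \<in> K"
  shows "(\<lambda>\<xi>. F \<xi> (f \<xi>)) \<in> K"
proof -
  have lin: "\<And>\<xi>. \<xi> \<in> space \<mu> \<Longrightarrow> hbounded_linear sc ip (F \<xi>)"
    and meas: "\<And>x y. (\<lambda>\<xi>. ip (F \<xi> x) y) \<in> borel_measurable \<mu>"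
    and adj: "AE \<xi> in \<mu>. hadjoint ip (F (cnj \<xi>)) (\<lambda>x. J (F \<xi> (J x)))"
    using F by (simp_all add: Linf_c_def Linf_op_def)
  obtain M' where M': "AE \<xi> in \<mu>. \<forall>x. nrm (F \<xi> x) \<le> M' * nrm x"
    using F unfolding Linf_c_def Linf_op_def by blast
  \<comment> \<open>Nothing forces \<open>M'\<close> to be nonnegative, for instance over a zero
    measure.\<close>
  define M where "M = max M' 0"
  have "AE \<xi> in \<mu>. (\<forall>x. nrm (F \<xi> x) \<le> M * nrm x) \<and> hadjoint ip (F (cnj \<xi>)) (\<lambda>x. J (F \<xi> (J x)))"
    using M' adj
  proof eventually_elim
    case (elim \<xi>)
    have "M' * nrm x \<le> M * nrm x" for x by (intro mult_right_mono) (auto simp: M_def)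
    then show ?case using elim by (meson order_trans)
  qed
  then obtain N where N: "N \<in> null_sets \<mu>"
    and good: "\<And>\<xi>. \<xi> \<in> space \<mu> - N \<Longrightarrow>
      (\<forall>x. nrm (F \<xi> x) \<le> M * nrm x) \<and> hadjoint ip (F (cnj \<xi>)) (\<lambda>x. J (F \<xi> (J x)))"
    by (rule AE_E3) blast
  \<comment> \<open>This set has full measure and is stable under reflection, so cutting
    \<open>F\<close> off outside it preserves the relation between conjugate fibres.\<close>
  define G where "G = {\<xi> \<in> space \<mu>. \<xi> \<notin> N \<and> cnj \<xi> \<notin> N}"
  have G_cnj: "cnj \<xi> \<in> G \<longleftrightarrow> \<xi> \<in> G" for \<xi> by (auto simp: G_def space_eq)
  have G_sets: "G \<in> sets \<mu>"
  proof -
    have "G = (space \<mu> - N) \<inter> (cnj -` (space \<mu> - N) \<inter> space \<mu>)"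
      by (auto simp: G_def space_eq)
    moreover have "space \<mu> - N \<in> sets \<mu>" using N by auto
    ultimately show ?thesis
      using measurable_sets[OF cnj_measurable, of "space \<mu> - N"] by auto
  qed
  have AE_G: "AE \<xi> in \<mu>. \<xi> \<in> G"
    using AE_not_in[OF N] AE_cnj[OF AE_not_in[OF N]] AE_space by eventually_elim (simp add: G_def)
  define F0 where "F0 \<xi> = (if \<xi> \<in> G then F \<xi> else (\<lambda>_. 0))" for \<xi>
  define F1 where "F1 \<xi> x = J (F0 (cnj \<xi>) (J x))" for \<xi> x
  have lin_G: "F \<xi> (x + y) = F \<xi> x + F \<xi> y" "F \<xi> (sc a x) = sc a (F \<xi> x)" if "\<xi> \<in> G" for \<xi> x y a
    using lin[of \<xi>] that by (auto simp: G_def hbounded_linear_def)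
  have F0: "F0 \<xi> (x + y) = F0 \<xi> x + F0 \<xi> y" "F0 \<xi> (sc a x) = sc a (F0 \<xi> x)"
    "nrm (F0 \<xi> x) \<le> M * nrm x" for \<xi> x y a
    using lin_G[of \<xi>] good[of \<xi>] by (auto simp: F0_def G_def M_def)
  have F1: "F1 \<xi> (x + y) = F1 \<xi> x + F1 \<xi> y" "F1 \<xi> (sc a x) = sc a (F1 \<xi> x)"
    "nrm (F1 \<xi> x) \<le> M * nrm x" for \<xi> x y a
    using F0(3)[of "cnj \<xi>" "J x"] by (simp_all add: F1_def J_add J_scale F0)
  have adj1: "ip (F1 \<xi> x) y = ip x (F0 \<xi> y)" for \<xi> x y
  proof (cases "\<xi> \<in> G")
    case True
    \<comment> \<open>The symmetry condition read at \<open>cnj \<xi>\<close> names the adjoint of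
      the fibre at \<open>\<xi>\<close>.\<close>
    then have "hadjoint ip (F \<xi>) (\<lambda>x. J (F (cnj \<xi>) (J x)))"
      using good[of "cnj \<xi>"] by (simp add: G_def space_eq)
    then show ?thesis using True G_cnj[of \<xi>] by (simp add: F1_def F0_def hadjoint_def)
  qed (simp add: F1_def F0_def G_cnj)
  have adj0: "ip (F0 \<xi> x) y = ip x (F1 \<xi> y)" for \<xi> x y
    using adj1[of \<xi> y x] ip_commute by metis
  have F0_meas: "(\<lambda>\<xi>. ip (F0 \<xi> x) y) \<in> borel_measurable \<mu>" for x y
  proof -
    have "(\<lambda>\<xi>. if \<xi> \<in> G then ip (F \<xi> x) y else 0) \<in> borel_measurable \<mu>"
      by (rule measurable_If_set[OF meas]) (use G_sets in auto)
    moreover have "(\<lambda>\<xi>. ip (F0 \<xi> x) y) = (\<lambda>\<xi>. if \<xi> \<in> G then ip (F \<xi> x) y else 0)"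
      by (auto simp: F0_def)
    ultimately show ?thesis by simp
  qed
  have F1_meas: "(\<lambda>\<xi>. ip (F1 \<xi> x) y) \<in> borel_measurable \<mu>" for x y
    unfolding F1_def ip_J_left by (intro borel_measurable_cnj measurable_comp_cnj F0_meas)
  \<comment> \<open>The combination is selfadjoint because \<open>F0\<close> and \<open>F1\<close>
    are adjoint, and symmetric because conjugation by \<open>J\<close> exchanges them at conjugate
    points. The values \<open>1/2\<close> and \<open>-\<i>/2\<close> of \<open>c\<close> give the
    real and imaginary parts.\<close>
  have sym_K: "(\<lambda>\<xi>. sc c (F0 \<xi> (f \<xi>)) + sc (cnj c) (F1 \<xi> (f \<xi>))) \<in> K" for c
  proof (rule K_selfadjoint[OF inv, where M = "2 * cmod c * M" and f = f
        and T = "\<lambda>\<xi> x. sc c (F0 \<xi> x) + sc (cnj c) (F1 \<xi> x)"])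
    fix \<xi> x y a
    show "sc c (F0 \<xi> (x + y)) + sc (cnj c) (F1 \<xi> (x + y))
        = (sc c (F0 \<xi> x) + sc (cnj c) (F1 \<xi> x)) + (sc c (F0 \<xi> y) + sc (cnj c) (F1 \<xi> y))"
      by (simp add: F0 F1 scale_right_distrib)
    show "sc c (F0 \<xi> (sc a x)) + sc (cnj c) (F1 \<xi> (sc a x)) = sc a (sc c (F0 \<xi> x) + sc (cnj c) (F1 \<xi> x))"
      by (simp add: F0 F1 scale_right_distrib mult.commute)
    have "nrm (sc c (F0 \<xi> x) + sc (cnj c) (F1 \<xi> x)) \<le> cmod c * nrm (F0 \<xi> x) + cmod c * nrm (F1 \<xi> x)"
      using nrm_triangle[of "sc c (F0 \<xi> x)" "sc (cnj c) (F1 \<xi> x)"] by (simp add: nrm_scale)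
    also have "\<dots> \<le> cmod c * (M * nrm x) + cmod c * (M * nrm x)"
      by (intro add_mono mult_left_mono F0 F1 norm_ge_zero)
    finally show "nrm (sc c (F0 \<xi> x) + sc (cnj c) (F1 \<xi> x)) \<le> 2 * cmod c * M * nrm x"
      by (simp add: mult_ac)
    show "0 \<le> 2 * cmod c * M" by (simp add: M_def)
    show "ip (sc c (F0 \<xi> x) + sc (cnj c) (F1 \<xi> x)) y = ip x (sc c (F0 \<xi> y) + sc (cnj c) (F1 \<xi> y))"
      by (simp add: ip_simps adj0 adj1)
    show "(\<lambda>\<xi>. ip (sc c (F0 \<xi> x) + sc (cnj c) (F1 \<xi> x)) y) \<in> borel_measurable \<mu>"
      unfolding ip_simps
      by (intro borel_measurable_add borel_measurable_times borel_measurable_const F0_meas F1_meas)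
    show "J (sc c (F0 \<xi> (J x)) + sc (cnj c) (F1 \<xi> (J x)))
        = sc c (F0 (cnj \<xi>) x) + sc (cnj c) (F1 (cnj \<xi>) x)"
      by (simp add: J_add J_scale F1_def)
  qed (rule f)
  have split: "F0 \<xi> x = (sc (1/2) (F0 \<xi> x) + sc (cnj (1/2)) (F1 \<xi> x))
      + sc \<i> (sc (- \<i>/2) (F0 \<xi> x) + sc (cnj (- \<i>/2)) (F1 \<xi> x))" for \<xi> x
  proof -
    have "sc (1/2) (F0 \<xi> x) + sc (1/2) (F0 \<xi> x) = F0 \<xi> x"
      by (simp flip: scale_left_distrib)
    moreover have "sc \<i> (sc (- \<i>/2) (F0 \<xi> x) + sc (cnj (- \<i>/2)) (F1 \<xi> x))
        = sc (1/2) (F0 \<xi> x) - sc (1/2) (F1 \<xi> x)"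
      unfolding scale_right_distrib scale_scale by (simp add: scale_minus_left)
    ultimately show ?thesis by (simp add: algebra_simps)
  qed
  have F0_K: "(\<lambda>\<xi>. F0 \<xi> (f \<xi>)) \<in> K"
    by (subst split) (rule K_add[OF sym_K K_scale[OF sym_K]])
  show ?thesis
  proof (rule K_cong[OF F0_K])
    show "AE \<xi> in \<mu>. F0 \<xi> (f \<xi>) = F \<xi> (f \<xi>)"
      using AE_G by eventually_elim (simp add: F0_def)
    have f_L2: "f \<in> L2 ip \<mu>" by (rule K_L2[OF f])
    show "(\<lambda>\<xi>. F \<xi> (f \<xi>)) \<in> L2 ip \<mu>"
    proof (rule L2_bounded[OF f_L2])
      show "hmeasurable ip \<mu> (\<lambda>\<xi>. F \<xi> (f \<xi>))"
        by (rule hmeasurable_apply[OF L2_hmeasurable[OF f_L2] lin meas])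
      show "AE \<xi> in \<mu>. nrm (F \<xi> (f \<xi>)) \<le> M' * nrm (f \<xi>)"
        using M' by eventually_elim simp
    qed
  qed
qed

section \<open>From invariance under multiplications to invariance under conjugations\<close>

lemma K_conjugation:
  assumes Js_K: "\<And>f. f \<in> K \<Longrightarrow> Js f \<in> K"
    and Linf_K: "\<And>F f. F \<in> Linf_c sc ip \<mu> J \<Longrightarrow> f \<in> K \<Longrightarrow> (\<lambda>\<xi>. F \<xi> (f \<xi>)) \<in> K"
    and C: "L2_conj sc ip \<mu> C" and C_xi: "commutes_Mxi sc ip \<mu> C" and f: "f \<in> K"
  shows "C f \<in> K"
proof -
  note * = C[unfolded L2_conj_def aeq_def]
  have C_L2: "\<And>f. f \<in> L2 ip \<mu> \<Longrightarrow> C f \<in> L2 ip \<mu>"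
    by (rule *[THEN conjunct1, rule_format])
  have C_cong: "\<And>f g. f \<in> L2 ip \<mu> \<Longrightarrow> g \<in> L2 ip \<mu> \<Longrightarrow> (AE \<xi> in \<mu>. f \<xi> = g \<xi>) \<Longrightarrow> AE \<xi> in \<mu>. C f \<xi> = C g \<xi>"
    by (rule *[THEN conjunct2, THEN conjunct1, rule_format])
  have C_add: "\<And>f g. f \<in> L2 ip \<mu> \<Longrightarrow> g \<in> L2 ip \<mu> \<Longrightarrow> AE \<xi> in \<mu>. C (\<lambda>\<xi>. f \<xi> + g \<xi>) \<xi> = C f \<xi> + C g \<xi>"
    by (rule *[THEN conjunct2, THEN conjunct2, THEN conjunct1, rule_format])
  have C_scale: "\<And>a f. f \<in> L2 ip \<mu> \<Longrightarrow> AE \<xi> in \<mu>. C (\<lambda>\<xi>. sc a (f \<xi>)) \<xi> = sc (cnj a) (C f \<xi>)"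
    by (rule *[THEN conjunct2, THEN conjunct2, THEN conjunct2, THEN conjunct1, rule_format])
  have C_norm: "\<And>f. f \<in> L2 ip \<mu> \<Longrightarrow> l2norm ip \<mu> (C f) = l2norm ip \<mu> f"
    by (rule *[THEN conjunct2, THEN conjunct2, THEN conjunct2, THEN conjunct2, THEN conjunct1, rule_format])
  have C_C: "\<And>f. f \<in> L2 ip \<mu> \<Longrightarrow> AE \<xi> in \<mu>. C (C f) \<xi> = f \<xi>"
    by (rule *[THEN conjunct2, THEN conjunct2, THEN conjunct2, THEN conjunct2, THEN conjunct2, rule_format])
  \<comment> \<open>Since \<open>C\<close> is an involution, inserting \<open>C f\<close> into the
    relation \<open>C M C = M\<close> turns it into commutation.\<close>
  have C_mult: "AE \<xi> in \<mu>. C (\<lambda>\<xi>. sc \<xi> (f \<xi>)) \<xi> = sc \<xi> (C f \<xi>)" if f: "f \<in> L2 ip \<mu>" for f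
  proof -
    have "AE \<xi> in \<mu>. C (\<lambda>\<xi>. sc \<xi> (C (C f) \<xi>)) \<xi> = C (\<lambda>\<xi>. sc \<xi> (f \<xi>)) \<xi>"
      using C_C[OF f] by (intro C_cong L2_mult_id C_L2 f) (auto elim: eventually_mono)
    moreover have "AE \<xi> in \<mu>. C (\<lambda>\<xi>. sc \<xi> (C (C f) \<xi>)) \<xi> = sc \<xi> (C f \<xi>)"
      using C_xi C_L2[OF f] unfolding commutes_Mxi_def aeq_def by (rule bspec)
    ultimately show ?thesis by eventually_elim simp
  qed
  define U where "U f = Js (C f)" for f
  have U_L2: "\<And>f. f \<in> L2 ip \<mu> \<Longrightarrow> U f \<in> L2 ip \<mu>"
    unfolding U_def by (rule L2_Js[OF C_L2])
  obtain F where F_ip: "\<And>\<xi> x y. ip (F \<xi> x) (F \<xi> y) = ip x y"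
    and F_meas: "\<And>x y. (\<lambda>\<xi>. ip (F \<xi> x) y) \<in> borel_measurable \<mu>"
    and UF: "\<And>f. f \<in> L2 ip \<mu> \<Longrightarrow> AE \<xi> in \<mu>. U f \<xi> = F \<xi> (f \<xi>)"
  proof (rule U_decomposable[of U])
    fix f g and a :: complex assume f: "f \<in> L2 ip \<mu>"
    show "U f \<in> L2 ip \<mu>" by (rule U_L2[OF f])
    show "AE \<xi> in \<mu>. U (\<lambda>\<xi>. sc a (f \<xi>)) \<xi> = sc a (U f \<xi>)"
      using Js_cong[OF C_scale[OF f, of a]]
      by eventually_elim (simp add: U_def Js_eq J_scale mult.commute)
    show "(\<integral>\<xi>. (nrm (U f \<xi>))\<^sup>2 \<partial>\<mu>) = (\<integral>\<xi>. (nrm (f \<xi>))\<^sup>2 \<partial>\<mu>)"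
      unfolding U_def integral_nrm_Js[OF C_L2[OF f]] by (metis l2norm_sq C_norm[OF f])
    \<comment> \<open>Reflection and antilinearity each conjugate the multiplier, so
      \<open>U\<close> commutes with multiplication by \<open>\<xi>\<close> itself.\<close>
    show "AE \<xi> in \<mu>. U (\<lambda>\<xi>. sc \<xi> (f \<xi>)) \<xi> = sc \<xi> (U f \<xi>)"
      using Js_cong[OF C_mult[OF f]]
      by eventually_elim (simp add: U_def Js_eq J_scale mult.commute)
    assume g: "g \<in> L2 ip \<mu>"
    show "AE \<xi> in \<mu>. U (\<lambda>\<xi>. f \<xi> + g \<xi>) \<xi> = U f \<xi> + U g \<xi>"
      using Js_cong[OF C_add[OF f g]]
      by eventually_elim (simp add: U_def Js_eq J_add scale_right_distrib)
    show "AE \<xi> in \<mu>. U f \<xi> = U g \<xi>" if "AE \<xi> in \<mu>. f \<xi> = g \<xi>"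
      unfolding U_def by (intro Js_cong C_cong f g that)
  qed blast
  note F_lin = ip_preserving_linear[of "F _", OF F_ip]
  have F_diff: "nrm (F \<xi> x - F \<xi> y) = nrm (x - y)" for \<xi> x y
    by (simp add: hnorm_def ip_simps F_ip)
  text \<open>\<open>J\<^sup># U J\<^sup># U = C C = 1\<close>, so the fibre of \<open>U\<close> at the conjugate point is, up to \<open>J\<close>,
    the inverse of the one at \<open>\<xi>\<close>.\<close>
  obtain d :: "nat \<Rightarrow> 'h" where d: "\<And>x e. e > 0 \<Longrightarrow> \<exists>k. nrm (x - d k) < e"
    using dense_sequence by blast
  have inv_d: "AE \<xi> in \<mu>. J (F (cnj \<xi>) (J (F \<xi> x))) = x" for x
  proof -
    have x: "(\<lambda>_. x) \<in> L2 ip \<mu>" by (rule L2_const)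
    have "AE \<xi> in \<mu>. U (Js (U (\<lambda>_. x))) \<xi> = Js (C (C (\<lambda>_. x))) \<xi>"
      unfolding U_def
      by (intro Js_cong C_cong L2_Js C_L2 x Js_Js)
    from AE_cnj[OF this] AE_cnj[OF Js_cong[OF C_C[OF x]]]
      AE_cnj[OF UF[OF L2_Js[OF U_L2[OF x]]]] UF[OF x] root_h_cnj h_cnj
    show ?thesis
    proof eventually_elim
      case (elim \<xi>)
      have "F (cnj \<xi>) (Js (U (\<lambda>_. x)) (cnj \<xi>)) = Js (\<lambda>_. x) (cnj \<xi>)"
        using elim(1-3) by simp
      then have "sc (root_h (cnj \<xi>)) (F (cnj \<xi>) (J (F \<xi> x))) = sc (root_h (cnj \<xi>)) (J x)"
        by (simp add: Js_eq elim(4) F_lin)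
      \<comment> \<open>The factor can be cancelled: its product with \<open>root_h \<xi>\<close> is
        1.\<close>
      moreover have "root_h (cnj \<xi>) \<noteq> 0" using elim(5) by auto
      ultimately have "F (cnj \<xi>) (J (F \<xi> x)) = J x" by simp
      then show ?case by simp
    qed
  qed
  have "AE \<xi> in \<mu>. \<forall>k. J (F (cnj \<xi>) (J (F \<xi> (d k)))) = d k"
    unfolding AE_all_countable by (intro allI inv_d)
  then have inv_all: "AE \<xi> in \<mu>. \<forall>x. J (F (cnj \<xi>) (J (F \<xi> x))) = x"
  proof eventually_elim
    case (elim \<xi>)
    show ?case
    proof
      fix x
      obtain k where k: "(\<lambda>n. nrm (d (k n) - x)) \<longlonglongrightarrow> 0"
        using approx_sequence[of d, OF d] by blast
      \<comment> \<open>An isometric map fixing a dense sequence fixes every vector, so one null set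
        serves all \<open>x\<close>.\<close>
      define W where "W x = J (F (cnj \<xi>) (J (F \<xi> x)))" for x
      have W: "nrm (W x - W y) = nrm (x - y)" for x y
        by (simp add: W_def F_diff flip: J_diff)
      have "(\<lambda>n. nrm (d (k n) - W x)) \<longlonglongrightarrow> 0"
        using k elim W[of "d (k _)" x] by (simp add: W_def)
      from tendsto_ip[OF this this] tendsto_ip[OF k this]
      have "(\<lambda>n. ip (d (k n)) (d (k n))) \<longlonglongrightarrow> ip (W x) (W x)"
        "(\<lambda>n. ip (d (k n)) (d (k n))) \<longlonglongrightarrow> ip x (W x)" by auto
      then have "ip x (W x) = ip (W x) (W x)" by (rule LIMSEQ_unique[rotated])
      moreover have "ip (W x) (W x) = ip x x"
        by (simp add: W_def ip_J F_ip)
      ultimately have "x = W x" by (intro eq_if_ip_eq) (simp_all add: nrm_sq)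
      then show "J (F (cnj \<xi>) (J (F \<xi> x))) = x" by (simp add: W_def)
    qed
  qed
  have "F \<in> Linf_c sc ip \<mu> J"
    unfolding Linf_c_def Linf_op_def mem_Collect_eq
  proof (intro conjI ballI allI exI)
    show "hbounded_linear sc ip (F \<xi>)" for \<xi>
      unfolding hbounded_linear_def using F_lin by (metis mult_1 order_refl)
    show "AE \<xi> in \<mu>. \<forall>x. nrm (F \<xi> x) \<le> 1 * nrm x" by (simp add: F_lin)
    show "AE \<xi> in \<mu>. hadjoint ip (F (cnj \<xi>)) (\<lambda>x. J (F \<xi> (J x)))"
      using AE_cnj[OF inv_all]
    proof eventually_elim
      case (elim \<xi>)
      show ?case
        unfolding hadjoint_def
      proof (intro allI)
        fix x y
        \<comment> \<open>Rewriting \<open>y\<close> by the inversion identity lets \<open>J\<close>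
          and \<open>F \<xi>\<close> be stripped from both arguments; the two conjugations
          cancel.\<close>
        have "ip (J (F \<xi> (J x))) y = ip (J (F \<xi> (J x))) (J (F \<xi> (J (F (cnj \<xi>) y))))"
          using elim by simp
        also have "\<dots> = ip x (F (cnj \<xi>) y)" by (simp add: ip_J F_ip)
        finally show "ip (J (F \<xi> (J x))) y = ip x (F (cnj \<xi>) y)" .
      qed
    qed
  qed (rule F_meas)
  then have JsF: "Js (\<lambda>\<xi>. F \<xi> (f \<xi>)) \<in> K" by (rule Js_K[OF Linf_K[OF _ f]])
  have f_L2: "f \<in> L2 ip \<mu>" by (rule K_L2[OF f])
  show "C f \<in> K"
  proof (rule K_cong[OF JsF C_L2[OF f_L2]])
    show "AE \<xi> in \<mu>. Js (\<lambda>\<xi>. F \<xi> (f \<xi>)) \<xi> = C f \<xi>"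
      using Js_cong[OF UF[OF f_L2]] Js_Js[of "C f"] by eventually_elim (simp add: U_def)
  qed
qed

end

theorem theorem10p1:
  fixes sc :: "complex \<Rightarrow> 'h::ab_group_add \<Rightarrow> 'h"
    and ip :: "'h \<Rightarrow> 'h \<Rightarrow> complex"
    and \<mu> :: "complex measure"
    and J :: "'h \<Rightarrow> 'h"
    and K :: "(complex \<Rightarrow> 'h) set"
  assumes H: "complex_hilbert sc ip"
    and fin: "finite_measure \<mu>"
    and borel_T: "sets \<mu> = sets (restrict_space borel circle)"
    and ac: "absolutely_continuous \<mu> (distr \<mu> \<mu> cnj)"
    and J: "hconj sc ip J"
    and K: "L2_closed_subspace sc ip \<mu> K"
  shows "(\<forall>C. L2_conj sc ip \<mu> C \<and> commutes_Mxi sc ip \<mu> C \<longrightarrow> (\<forall>f\<in>K. C f \<in> K))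
     \<longleftrightarrow> ((\<forall>f\<in>K. Jsharp sc \<mu> J f \<in> K) \<and>
          (\<forall>F\<in>Linf_c sc ip \<mu> J. \<forall>f\<in>K. (\<lambda>\<xi>. F \<xi> (f \<xi>)) \<in> K))"
    (is "?a \<longleftrightarrow> ?b")
proof -
  interpret invariant_subspace sc ip J \<mu> K
    by (intro invariant_subspace.intro conjugation_L2.intro hilbert_conjugation.intro vector_L2.intro
        hilbert_structure.intro circle_measure.intro hilbert_conjugation_axioms.intro
        circle_measure_axioms.intro invariant_subspace_axioms.intro assms)
  show ?thesis
  proof
    assume inv: ?a
    show ?b
    proof (intro conjI ballI)
      show "Js f \<in> K" if "f \<in> K" for f
        by (rule K_Js[OF inv that])
      show "(\<lambda>\<xi>. F \<xi> (f \<xi>)) \<in> K" if "F \<in> Linf_c sc ip \<mu> J" "f \<in> K" for F f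
        by (rule K_Linf_c[OF inv that])
    qed
  next
    assume b: ?b
    show ?a
    proof (intro allI impI ballI, elim conjE)
      fix C f
      assume "L2_conj sc ip \<mu> C" "commutes_Mxi sc ip \<mu> C" "f \<in> K"
      then show "C f \<in> K"
        by (rule K_conjugation[rotated 2]) (simp_all add: b)
    qed
  qed
qed

end
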